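(* For every real $\delta > 0$ and every prime $p$ there exist $J_0 = J_0(\delta,p)$ and $N_0 = N_0(\delta,p)$ such that the following holds for all dimensions $n \ge N_0$. Let $F = p^n$ and let $f : \mathbb{F}_{p^n} \to [0,1]$ with $\mathbb{E}(f) = \theta$, where $$F^{-1/9} < \theta \le 1.$$ Suppose that for some integer $j$ satisfying $J_0(\delta,p) < j < F^{1/8}$ we have $$|\hat f(a_j)| < \theta^{\,j^{1/2+\delta}} F.$$ Then $S = \{m \in \mathbb{F}_{p^n} : f(m) > 0\}$ contains a three-term arithmetic progression; more specifically, $$\Lambda(f) > \theta F^{-1}.$$
   Context: Here $p$ is a prime, $n \ge 1$, and $\mathbb{F}_{p^n}$ is regarded as the $n$-dimensional vector space $\mathbb{F}_p^n$ over $\mathbb{F}_p$, with usual dot product $a\cdot m \in \mathbb{F}_p$; $F = |\mathbb{F}_{p^n}| = p^n$. For $f:\mathbb{F}_{p^n}\to[0,1]$: $\mathbb{E}(f) = F^{-1}\sum_{m\in \mathbb{F}_{p^n}} f(m)$; $\Lambda(f) = F^{-2}\sum_{m,d\in\mathbb{F}_{p^n}} f(m)f(m+d)f(m+2d)$; and $\hat f(a) = \sum_{m\in\mathbb{F}_{p^n}} f(m) e^{2\pi i (a\cdot m)/p}$. The elements of $\mathbb{F}_{p^n}$ are listed as $a_1,\dots,a_F$ so that $|\hat f(a_1)| \ge |\hat f(a_2)| \ge \cdots \ge |\hat f(a_F)|$, with $a_1 = 0$ and, for $p$ odd, $a_2=-a_3,\ a_4=-a_5,\dots$ (possible since $\hat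 f(a)=\overline{\hat f(-a)}$). So $|\hat f(a_j)|$ is the $j$-th largest Fourier coefficient magnitude, counted with multiplicity. A three-term arithmetic progression is a triple $m, m+d, m+2d$, non-trivial if $d \neq 0$. The inequality $\Lambda(f) > \theta F^{-1}$ implies that $S$ contains a non-trivial one. *)

theory Defs
  imports
    Complex_Main
    "Jordan_Normal_Form.Matrix"
    "Berlekamp_Zassenhaus.Finite_Field"
begin

text \<open>
  The space of dimension \<open>n\<close> over the field with \<open>p = CARD('p)\<close> elements is
  \<open>carrier_vec n :: 'p mod_ring vec set\<close>, where the class \<open>prime_card\<close> says that \<open>p\<close> is
  prime. Functions on the space are total functions on \<open>'p mod_ring vec\<close>, of which only the
  values on \<open>carrier_vec n\<close> matter.
\<close>

definition mean :: "nat \<Rightarrow> ('p::prime_card mod_ring vec \<Rightarrow> real) \<Rightarrow> real" where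
  "mean n f = (\<Sum>m\<in>carrier_vec n. f m) / real (CARD('p) ^ n)"

definition AP3_density :: "nat \<Rightarrow> ('p::prime_card mod_ring vec \<Rightarrow> real) \<Rightarrow> real" where
  "AP3_density n f =
     (\<Sum>m\<in>carrier_vec n. \<Sum>d\<in>carrier_vec n. f m * f (m + d) * f (m + 2 \<cdot>\<^sub>v d))
       / real (CARD('p) ^ n) ^ 2"

text \<open>
  The dot product lives in the prime field; \<open>to_int_mod_ring\<close> picks its representative in
  \<open>{0..<p}\<close>, on whose choice the exponential does not depend.
\<close>

definition fourier ::
  "nat \<Rightarrow> ('p::prime_card mod_ring vec \<Rightarrow> real) \<Rightarrow> 'p mod_ring vec \<Rightarrow> complex" where
  "fourier n f a =
     (\<Sum>m\<in>carrier_vec n. complex_of_real (f m) *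
        exp (2 * of_real pi * \<i> * of_int (to_int_mod_ring (scalar_prod a m)) / of_nat CARD('p)))"

text \<open>
  An enumeration \<open>a 1, \<dots>, a F\<close> (with \<open>F = p ^ n\<close>) of the space by decreasing size of the Fourier
  coefficients of \<open>f\<close>. It starts with \<open>0\<close>, and for odd \<open>p\<close> it continues with pairs of
  opposite vectors, whose coefficients have the same size. Values of \<open>a\<close> outside \<open>{1..F}\<close>
  are irrelevant.
\<close>

definition fourier_enumeration ::
  "nat \<Rightarrow> ('p::prime_card mod_ring vec \<Rightarrow> real) \<Rightarrow> (nat \<Rightarrow> 'p mod_ring vec) \<Rightarrow> bool" where
  "fourier_enumeration n f a \<longleftrightarrow>
     bij_betw a {1..CARD('p) ^ n} (carrier_vec n) \<and>
     (\<forall>i j. 1 \<le> i \<and> i \<le> j \<and> j \<le> CARD('p) ^ n \<longrightarrow>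
        norm (fourier n f (a j)) \<le> norm (fourier n f (a i))) \<and>
     a 1 = 0\<^sub>v n \<and>
     (odd CARD('p) \<longrightarrow> (\<forall>k\<ge>1. 2 * k + 1 \<le> CARD('p) ^ n \<longrightarrow> a (2 * k) = - a (2 * k + 1)))"

end

theory Submission
  imports
    Defs
    "HOL-Library.Function_Algebras"
begin

text \<open>
  Throughout, \<open>F\<close> is the size of the space, \<open>\<Lambda> F\<^sup>2\<close> is the weighted count of progressions (\<open>ap3\<close>
  below), and \<open>ft f\<close> is the Fourier transform. The count of trivial progressions is at most
  \<open>\<theta> F\<close>, so everything follows from \<open>ap3 f > \<theta> F\<close>. Suppose this fails.

  Structure of the large spectrum. For all frequencies \<open>x\<close>, \<open>y\<close>, \<open>z\<close> the sum
  \<open>\<Sum>t. ft f (x + t) \<cdot> ft f (y - 2t) \<cdot> ft f (z + t)\<close> is \<open>F\<close> times a count of progressions twisted by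
  characters, hence at most \<open>F \<cdot> ap3 f\<close> in size (\<open>sum_ft_triple\<close>). If the three coefficients at
  \<open>x\<close>, \<open>y\<close>, \<open>z\<close> are large, the term \<open>t = 0\<close> is too big to stand alone, so some \<open>t \<noteq> 0\<close> must
  move the whole triple into the set \<open>X\<close> of large frequencies. The same holds modulo a subspace
  \<open>U\<close> of frequencies, after restricting \<open>f\<close> to a coset of the orthogonal complement of \<open>U\<close>, with
  \<open>t \<notin> U\<close> in place of \<open>t \<noteq> 0\<close> (\<open>unique_triple_bound\<close>).

  Removing popular differences. Call \<open>t\<close> popular if at least \<open>P\<close> elements of \<open>X\<close> stay in
  \<open>X + U\<close> when shifted by \<open>t\<close>. Adding a popular \<open>t \<notin> U\<close> to \<open>U\<close> identifies at least \<open>P/2\<close>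
  elements of \<open>X\<close> with others, so after at most \<open>2|X|/P\<close> additions no difference outside \<open>U\<close> is
  popular (\<open>remove_popular_differences\<close>). Each addition costs at most a factor \<open>p\<close> of the mass of \<open>f\<close>.

  Counting. Let \<open>Y \<subseteq> X\<close> consist of the frequencies that are large on a higher scale. Every triple
  of \<open>Y\<close> has its shift \<open>t\<close>, there are at most \<open>|Y||X|\<close> values of \<open>t\<close>, and each of them serves
  fewer than \<open>P\<^sup>2\<close> choices of the other two entries; so \<open>|Y|\<^sup>2 \<le> |X| P\<^sup>2\<close>
  (\<open>spectrum_shrinks\<close>). With \<open>P\<close> about \<open>\<surd>|X| / k\<^sup>2\<close> this gives \<open>|Y| \<le> |X| / k\<^sup>2\<close>.

  Iteration (\<open>no_moderate_spectral_gap\<close>). Repeating this with \<open>Y\<close> for \<open>X\<close> empties the spectrum,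
  although the frequency \<open>0\<close> is always in it: a contradiction. The dimensions of the subspaces added
  sum up to \<open>O(\<surd>j)\<close>, because \<open>|X|\<close> decreases geometrically. A round replaces the relative
  threshold \<open>\<epsilon>\<close> by \<open>\<epsilon>\<^bsup>1/4\<^esup>\<close>, and there are about \<open>log j / log k\<^sup>2\<close> rounds. So the first threshold must
  be about \<open>\<theta>\<close> to the power \<open>\<surd>j \<cdot> 4\<^sup>s\<close> where \<open>4\<^sup>s \<le> j\<^bsup>\<delta>/4\<^esup>\<close> if \<open>k\<close> is large: this is where
  the exponent \<open>1/2 + \<delta>\<close> comes from.

  The argument needs thresholds above \<open>1/F\<close>. If the given one is below \<open>F\<^bsup>-4\<^esup>\<close>, then \<open>f\<close> is nearly a
  trigonometric polynomial with fewer than \<open>F\<^bsup>1/8\<^esup>\<close> terms and an uncertainty principle gives the claim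
  (\<open>ap3_ge_of_sparse_spectrum\<close>); \<open>gap_parameters\<close> shows that nothing lies between the two cases.
  The cases \<open>p = 2\<close> and \<open>\<theta> > 3/4\<close> are elementary.
\<close>

section \<open>The standard additive character of a prime field\<close>

definition echar :: "'p::prime_card mod_ring \<Rightarrow> complex" where
  "echar k = exp (2 * of_real pi * \<i> * of_int (to_int_mod_ring k) / of_nat CARD('p))"

lemma echar_cis: "echar k = cis (2 * pi * of_int (to_int_mod_ring k) / real CARD('p))"
  for k :: "'p::prime_card mod_ring"
  by (simp add: echar_def cis_conv_exp mult_ac)

lemma echar_0 [simp]: "echar 0 = 1"
  by (simp add: echar_def)

lemma norm_echar [simp]: "norm (echar k) = 1"
  by (simp add: echar_def)

lemma echar_nonzero [simp]: "echar k \<noteq> 0"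
  by (simp add: echar_def)

lemma echar_add: "echar (k + l) = echar k * echar (l :: 'p::prime_card mod_ring)"
proof -
  define p where "p = int CARD('p)"
  define s where "s = to_int_mod_ring k + to_int_mod_ring l"
  have p0: "p \<noteq> 0" unfolding p_def by simp
  have "to_int_mod_ring (k + l) = s mod p"
    by (simp add: to_int_mod_ring_add s_def p_def)
  also have "\<dots> = s - p * (s div p)"
    by (simp add: minus_mult_div_eq_mod)
  finally have eq: "to_int_mod_ring (k + l) = s - p * (s div p)" .
  have "2 * pi * of_int (to_int_mod_ring (k + l)) / real CARD('p)
      = 2 * pi * of_int (to_int_mod_ring k) / real CARD('p) + 2 * pi * of_int (to_int_mod_ring l) / real CARD('p)
        + 2 * pi * of_int (- (s div p))"
  proof -
    have "real_of_int (to_int_mod_ring (k + l)) = of_int (to_int_mod_ring k) + of_int (to_int_mod_ring l)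
        + real CARD('p) * of_int (- (s div p))"
      unfolding eq by (simp add: s_def p_def)
    then show ?thesis
      by (simp add: distrib_left right_diff_distrib add_divide_distrib diff_divide_distrib)
  qed
  moreover have "cis (2 * pi * of_int (- (s div p))) = 1"
    by (rule cis_multiple_2pi) simp
  ultimately show ?thesis
    by (simp only: echar_cis cis_mult[symmetric] mult_1_right)
qed

lemma echar_minus: "echar (- k) = cnj (echar k)"
proof -
  have "echar (- k) * echar k = 1"
    using echar_add[of "- k" k] by simp
  moreover have "cnj (echar k) * echar k = 1"
    using complex_norm_square[of "echar k"] by (simp add: mult.commute)
  ultimately show ?thesis
    by (metis echar_nonzero mult_right_cancel)
qed

lemma echar_eq_1_iff: "echar k = 1 \<longleftrightarrow> k = (0 :: 'p::prime_card mod_ring)"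
proof
  assume "echar k = 1"
  then have "cos (2 * pi * of_int (to_int_mod_ring k) / real CARD('p)) = 1"
    unfolding echar_cis by (simp add: complex_eq_iff)
  then obtain n :: int where n: "2 * pi * of_int (to_int_mod_ring k) / real CARD('p) = of_int n * 2 * pi"
    unfolding cos_one_2pi_int by blast
  have pos: "real CARD('p) > 0" by simp
  from n have "real_of_int (to_int_mod_ring k) = real_of_int (n * int CARD('p))"
    using pos pi_gt_zero by (simp add: field_simps)
  then have e: "to_int_mod_ring k = n * int CARD('p)"
    by linarith
  have "to_int_mod_ring k \<in> {0..<int CARD('p)}"
    using range_to_int_mod_ring by blast
  then have "to_int_mod_ring k = to_int_mod_ring k mod int CARD('p)"
    by (intro mod_pos_pos_trivial[symmetric]) (simp_all only: atLeastLessThan_iff)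
  also have "\<dots> = 0"
    unfolding e by (rule mod_mult_self2_is_0)
  finally show "k = 0"
    by (metis of_int_mod_ring_to_int_mod_ring of_int_0 of_int_of_int_mod_ring)
qed (simp only: echar_0)

lemma two_neq_0_mod_ring:
  assumes "odd CARD('p::prime_card)"
  shows "(2 :: 'p mod_ring) \<noteq> 0"
proof
  assume "(2 :: 'p mod_ring) = 0"
  then have "of_nat 2 = (0 :: 'p mod_ring)" by simp
  then have "CARD('p) dvd 2" by (rule of_nat_0_mod_ring_dvd)
  then have "CARD('p) \<le> 2" by (rule dvd_imp_le) simp
  moreover have "CARD('p) \<ge> 2" using prime_ge_2_nat[OF prime_card[where ?'a = 'p]] .
  ultimately show False using assms by simp
qed

lemma sum_echar_mult:
  "(\<Sum>k\<in>UNIV. echar (k * x)) = (if x = 0 then of_nat CARD('p) else 0)"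
  for x :: "'p::prime_card mod_ring"
proof (cases "x = 0")
  case False
  have "(\<Sum>k\<in>UNIV. echar (k * x)) = (\<Sum>k\<in>UNIV. echar ((1 + k) * x))"
    by (rule sum.reindex_bij_witness[where i = "\<lambda>k. 1 + k" and j = "\<lambda>k. k - 1"]) auto
  also have "\<dots> = echar x * (\<Sum>k\<in>UNIV. echar (k * x))"
    by (simp only: distrib_right mult_1 echar_add sum_distrib_left)
  finally have "(1 - echar x) * (\<Sum>k\<in>UNIV. echar (k * x)) = 0"
    by (simp only: left_diff_distrib mult_1 right_minus_eq)
  moreover have "1 - echar x \<noteq> 0"
    using False echar_eq_1_iff[of x] by (simp only: right_minus_eq) metis
  ultimately have "(\<Sum>k\<in>UNIV. echar (k * x)) = 0"
    by (simp only: mult_eq_0_iff simp_thms)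
  with False show ?thesis by (simp only: if_False)
qed simp

section \<open>Fourier analysis on a finite space with a dot product\<close>

text \<open>
  A finite space \<open>V\<close> inside a type of class \<open>ab_group_add\<close>: sums over \<open>V\<close> carry the analysis, while
  the group laws hold for all elements of the type, so that shifts of frequencies can be rearranged
  without side conditions.
\<close>

locale dot_space = vector_space scale
  for scale :: "'p::prime_card mod_ring \<Rightarrow> 'v::ab_group_add \<Rightarrow> 'v" (infixr "*s" 75) +
  fixes V :: "'v set" and dot :: "'v \<Rightarrow> 'v \<Rightarrow> 'p mod_ring" (infixl "\<cdot>" 70)
  assumes subspace_V: "subspace V"
    and finite_V: "finite V"
    and dot_add_left: "(x + y) \<cdot> m = x \<cdot> m + y \<cdot> m"
    and dot_add_right: "x \<cdot> (m + d) = x \<cdot> m + x \<cdot> d"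
    and dot_scale_left: "(k *s x) \<cdot> m = k * (x \<cdot> m)"
    and nondegenerate: "m \<in> V \<Longrightarrow> m \<noteq> 0 \<Longrightarrow> \<exists>x\<in>V. x \<cdot> m \<noteq> 0"
begin

abbreviation F :: real where "F \<equiv> real (card V)"

lemma dot_zero_left [simp]: "0 \<cdot> m = 0"
  using dot_add_left[of 0 0 m] unfolding add_0_left by (simp only: add_cancel_right_right)

lemma dot_zero_right [simp]: "x \<cdot> 0 = 0"
  using dot_add_right[of x 0 0] unfolding add_0_left by (simp only: add_cancel_right_right)

lemma dot_minus_left: "(- x) \<cdot> m = - (x \<cdot> m)"
  using dot_add_left[of "- x" x m] by (simp add: eq_neg_iff_add_eq_0)

lemma dot_minus_right: "x \<cdot> (- m) = - (x \<cdot> m)"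
  using dot_add_right[of x "- m" m] by (simp add: eq_neg_iff_add_eq_0)

lemma dot_diff_left: "(x - y) \<cdot> m = x \<cdot> m - y \<cdot> m"
  using dot_add_left[of x "- y" m] by (simp add: dot_minus_left)

lemma dot_diff_right: "x \<cdot> (m - d) = x \<cdot> m - x \<cdot> d"
  using dot_add_right[of x m "- d"] by (simp add: dot_minus_right)

lemmas dot_simps = dot_add_left dot_add_right dot_minus_left dot_minus_right
  dot_diff_left dot_diff_right dot_scale_left

lemmas V_add = subspace_add[OF subspace_V] and V_diff = subspace_diff[OF subspace_V]
  and V_neg = subspace_neg[OF subspace_V] and V_scale = subspace_scale[OF subspace_V]
  and V_0 = subspace_0[OF subspace_V]

lemma card_field_gt_1: "real CARD('p) > 1"
  using prime_gt_1_nat[OF prime_card[where ?'a = 'p]] by simp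

lemma F_ge_1: "F \<ge> 1"
proof -
  have "card V > 0" using V_0 finite_V card_gt_0_iff by blast
  then show ?thesis by linarith
qed

lemma bij_translate:
  assumes "x \<in> V" shows "bij_betw (\<lambda>t. x + t) V V"
  by (rule bij_betw_byWitness[where f' = "\<lambda>t. t - x"]) (auto intro: V_add V_diff assms)

lemma sum_translate:
  assumes "x \<in> V" shows "(\<Sum>t\<in>V. h (x + t)) = (\<Sum>t\<in>V. h t)"
  using sum.reindex_bij_betw[OF bij_translate[OF assms]] .

lemma sum_translate_right:
  assumes "x \<in> V" shows "(\<Sum>t\<in>V. h (t + x)) = (\<Sum>t\<in>V. h t)"
  using sum_translate[OF assms] by (simp add: add.commute)

lemma sum_echar:
  assumes "m \<in> V"
  shows "(\<Sum>a\<in>V. echar (a \<cdot> m)) = (if m = 0 then of_real F else 0)"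
proof (cases "m = 0")
  case False
  then obtain w where w: "w \<in> V" "w \<cdot> m \<noteq> 0"
    using nondegenerate assms by blast
  have "(\<Sum>a\<in>V. echar (a \<cdot> m)) = (\<Sum>a\<in>V. echar ((w + a) \<cdot> m))"
    using sum_translate[OF w(1), of "\<lambda>a. echar (a \<cdot> m)"] by simp
  also have "\<dots> = echar (w \<cdot> m) * (\<Sum>a\<in>V. echar (a \<cdot> m))"
    by (simp add: dot_add_left echar_add sum_distrib_left)
  finally have "(1 - echar (w \<cdot> m)) * (\<Sum>a\<in>V. echar (a \<cdot> m)) = 0"
    by (simp only: left_diff_distrib mult_1 right_minus_eq)
  moreover have "1 - echar (w \<cdot> m) \<noteq> 0"
    using w(2) echar_eq_1_iff[of "w \<cdot> m"] by (simp only: right_minus_eq) (metis)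
  ultimately have "(\<Sum>a\<in>V. echar (a \<cdot> m)) = 0"
    by (simp only: mult_eq_0_iff simp_thms)
  with False show ?thesis by (simp only: if_False)
next
  case True
  show ?thesis unfolding True dot_zero_right echar_0 by simp
qed

definition ft :: "('v \<Rightarrow> real) \<Rightarrow> 'v \<Rightarrow> complex" where
  "ft g a = (\<Sum>m\<in>V. of_real (g m) * echar (a \<cdot> m))"

lemma norm_ft_le:
  assumes "\<And>m. m \<in> V \<Longrightarrow> 0 \<le> g m"
  shows "norm (ft g a) \<le> (\<Sum>m\<in>V. g m)"
  unfolding ft_def by (rule sum_norm_le) (simp only: norm_mult norm_echar norm_of_real assms abs_of_nonneg mult_1_right)

lemma ft_0: "ft g 0 = of_real (\<Sum>m\<in>V. g m)"
  by (simp add: ft_def)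

lemma parseval: "(\<Sum>a\<in>V. (norm (ft g a))\<^sup>2) = F * (\<Sum>m\<in>V. (g m)\<^sup>2)"
proof -
  have "(\<Sum>a\<in>V. ft g a * cnj (ft g a))
      = (\<Sum>a\<in>V. \<Sum>m\<in>V. \<Sum>m'\<in>V. of_real (g m) * of_real (g m') * echar (a \<cdot> (m - m')))"
  proof (rule sum.cong[OF refl])
    fix a
    have e: "echar (a \<cdot> m) * cnj (echar (a \<cdot> m')) = echar (a \<cdot> (m - m'))" for m m'
      using echar_add[of "a \<cdot> m" "- (a \<cdot> m')"] by (simp add: dot_diff_right echar_minus)
    have *: "of_real (g m) * echar (a \<cdot> m) * (of_real (g m') * cnj (echar (a \<cdot> m')))
        = of_real (g m) * of_real (g m') * echar (a \<cdot> (m - m'))" for m m'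
    proof -
      have "of_real (g m) * echar (a \<cdot> m) * (of_real (g m') * cnj (echar (a \<cdot> m')))
          = of_real (g m) * of_real (g m') * (echar (a \<cdot> m) * cnj (echar (a \<cdot> m')))"
        by (simp only: mult_ac)
      then show ?thesis by (simp only: e)
    qed
    show "ft g a * cnj (ft g a)
        = (\<Sum>m\<in>V. \<Sum>m'\<in>V. of_real (g m) * of_real (g m') * echar (a \<cdot> (m - m')))"
      by (simp add: ft_def sum_product *)
  qed
  also have "\<dots> = (\<Sum>m\<in>V. \<Sum>m'\<in>V. of_real (g m) * of_real (g m') * (\<Sum>a\<in>V. echar (a \<cdot> (m - m'))))"
    unfolding sum_distrib_left
    by (subst sum.swap, rule sum.cong[OF refl], rule sum.swap)
  also have "\<dots> = (\<Sum>m\<in>V. \<Sum>m'\<in>V. if m' = m then of_real (g m) * of_real (g m') * of_real F else 0)"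
    by (intro sum.cong refl) (auto simp: sum_echar V_diff)
  also have "\<dots> = of_real (F * (\<Sum>m\<in>V. (g m)\<^sup>2))"
    by (simp add: finite_V sum_distrib_left power2_eq_square mult_ac)
  also have "(\<Sum>a\<in>V. ft g a * cnj (ft g a)) = of_real (\<Sum>a\<in>V. (norm (ft g a))\<^sup>2)"
    unfolding of_real_sum by (intro sum.cong refl) (rule complex_norm_square[symmetric])
  finally have "of_real (\<Sum>a\<in>V. (norm (ft g a))\<^sup>2) = (of_real (F * (\<Sum>m\<in>V. (g m)\<^sup>2)) :: complex)" .
  then show ?thesis by (simp only: of_real_eq_iff)
qed

definition ap3 :: "('v \<Rightarrow> real) \<Rightarrow> real" where
  "ap3 g = (\<Sum>m\<in>V. \<Sum>d\<in>V. g m * g (m + d) * g (m + d + d))"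

text \<open>
  The Fourier coefficient at \<open>(x, y, z)\<close> of the measure counting progressions.
\<close>

definition twisted_ap3 :: "('v \<Rightarrow> real) \<Rightarrow> 'v \<Rightarrow> 'v \<Rightarrow> 'v \<Rightarrow> complex" where
  "twisted_ap3 g x y z = (\<Sum>m\<in>V. \<Sum>d\<in>V. of_real (g m * g (m + d) * g (m + d + d)) *
     echar (x \<cdot> m + y \<cdot> (m + d) + z \<cdot> (m + d + d)))"

lemma norm_twisted_ap3_le:
  assumes "\<And>m. m \<in> V \<Longrightarrow> 0 \<le> g m"
  shows "norm (twisted_ap3 g x y z) \<le> ap3 g"
  unfolding twisted_ap3_def ap3_def
proof (intro sum_norm_le)
  fix m d assume "m \<in> V" "d \<in> V"
  then have "0 \<le> g m * g (m + d) * g (m + d + d)"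
    by (intro mult_nonneg_nonneg assms V_add)
  then show "norm (of_real (g m * g (m + d) * g (m + d + d)) * echar (x \<cdot> m + y \<cdot> (m + d) + z \<cdot> (m + d + d)))
      \<le> g m * g (m + d) * g (m + d + d)"
    by (simp only: norm_mult norm_echar norm_of_real abs_of_nonneg mult_1_right)
qed

lemma ap3_mono:
  assumes "\<And>m. m \<in> V \<Longrightarrow> 0 \<le> g m" "\<And>m. m \<in> V \<Longrightarrow> g m \<le> f m"
  shows "ap3 g \<le> ap3 f"
  unfolding ap3_def
proof (intro sum_mono)
  fix m d assume "m \<in> V" "d \<in> V"
  then have "m + d \<in> V" "m + d + d \<in> V" by (auto intro: V_add)
  note V = \<open>m \<in> V\<close> this
  have f: "0 \<le> f m" if "m \<in> V" for m using assms that by fastforce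
  show "g m * g (m + d) * g (m + d + d) \<le> f m * f (m + d) * f (m + d + d)"
    by (intro mult_mono mult_nonneg_nonneg assms f V)
qed

text \<open>
  Summing over \<open>t\<close> leaves the triples \<open>(m\<^sub>1, m\<^sub>2, m\<^sub>3)\<close> with \<open>m\<^sub>1 - 2m\<^sub>2 + m\<^sub>3 = 0\<close>, which are the
  progressions; moving \<open>(x, y, z)\<close> along \<open>(1, -2, 1)\<close> does not change the character on them.
\<close>

lemma sum_ft_triple:
  "(\<Sum>t\<in>V. ft g (x + t) * ft g (y - (t + t)) * ft g (z + t)) = of_real F * twisted_ap3 g x y z"
proof -
  let ?G = "\<lambda>m1 m2 m3. of_real (g m1 * g m2 * g m3) * echar (x \<cdot> m1 + y \<cdot> m2 + z \<cdot> m3)"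
  have "(\<Sum>t\<in>V. ft g (x + t) * ft g (y - (t + t)) * ft g (z + t))
      = (\<Sum>t\<in>V. \<Sum>m1\<in>V. \<Sum>m2\<in>V. \<Sum>m3\<in>V. ?G m1 m2 m3 * echar (t \<cdot> (m1 - (m2 + m2) + m3)))"
  proof (rule sum.cong[OF refl])
    fix t
    have "ft g (x + t) * ft g (y - (t + t)) * ft g (z + t)
        = (\<Sum>m1\<in>V. \<Sum>m2\<in>V. \<Sum>m3\<in>V. of_real (g m1) * echar ((x + t) \<cdot> m1) *
             (of_real (g m2) * echar ((y - (t + t)) \<cdot> m2)) * (of_real (g m3) * echar ((z + t) \<cdot> m3)))"
      unfolding ft_def sum_product unfolding sum_distrib_right unfolding sum_distrib_left
      by (rule sum.cong[OF refl]) (rule sum.swap)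
    also have "\<dots> = (\<Sum>m1\<in>V. \<Sum>m2\<in>V. \<Sum>m3\<in>V. ?G m1 m2 m3 * echar (t \<cdot> (m1 - (m2 + m2) + m3)))"
    proof (intro sum.cong refl)
      fix m1 m2 m3
      have "(x + t) \<cdot> m1 + (y - (t + t)) \<cdot> m2 + (z + t) \<cdot> m3
          = (x \<cdot> m1 + y \<cdot> m2 + z \<cdot> m3) + t \<cdot> (m1 - (m2 + m2) + m3)"
        by (simp add: dot_simps algebra_simps)
      from arg_cong[OF this, of echar]
      have e: "echar ((x + t) \<cdot> m1) * echar ((y - (t + t)) \<cdot> m2) * echar ((z + t) \<cdot> m3)
          = echar (x \<cdot> m1 + y \<cdot> m2 + z \<cdot> m3) * echar (t \<cdot> (m1 - (m2 + m2) + m3))"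
        by (simp only: echar_add)
      have "of_real (g m1) * echar ((x + t) \<cdot> m1) * (of_real (g m2) * echar ((y - (t + t)) \<cdot> m2))
            * (of_real (g m3) * echar ((z + t) \<cdot> m3))
          = of_real (g m1 * g m2 * g m3)
            * (echar ((x + t) \<cdot> m1) * echar ((y - (t + t)) \<cdot> m2) * echar ((z + t) \<cdot> m3))"
        by (simp only: of_real_mult mult_ac)
      then show "of_real (g m1) * echar ((x + t) \<cdot> m1) * (of_real (g m2) * echar ((y - (t + t)) \<cdot> m2))
            * (of_real (g m3) * echar ((z + t) \<cdot> m3))
          = ?G m1 m2 m3 * echar (t \<cdot> (m1 - (m2 + m2) + m3))"
        unfolding e by (simp only: mult.assoc)
    qed
    finally show "ft g (x + t) * ft g (y - (t + t)) * ft g (z + t)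
        = (\<Sum>m1\<in>V. \<Sum>m2\<in>V. \<Sum>m3\<in>V. ?G m1 m2 m3 * echar (t \<cdot> (m1 - (m2 + m2) + m3)))" .
  qed
  also have "\<dots> = (\<Sum>m1\<in>V. \<Sum>m2\<in>V. \<Sum>m3\<in>V. ?G m1 m2 m3 * (\<Sum>t\<in>V. echar (t \<cdot> (m1 - (m2 + m2) + m3))))"
    unfolding sum_distrib_left
    by (subst sum.swap, rule sum.cong[OF refl], subst sum.swap, rule sum.cong[OF refl], rule sum.swap)
  also have "\<dots> = (\<Sum>m1\<in>V. \<Sum>m2\<in>V. \<Sum>m3\<in>V. if m3 = m2 + m2 - m1 then ?G m1 m2 m3 * of_real F else 0)"
  proof (intro sum.cong refl)
    fix m1 m2 m3 assume "m1 \<in> V" "m2 \<in> V" "m3 \<in> V"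
    then have V: "m1 - (m2 + m2) + m3 \<in> V" by (intro V_add V_diff)
    have "m1 - (m2 + m2) + m3 = m3 - (m2 + m2 - m1)"
      by (simp only: diff_conv_add_uminus minus_add_distrib minus_minus add_ac)
    then have iff: "m1 - (m2 + m2) + m3 = 0 \<longleftrightarrow> m3 = m2 + m2 - m1"
      by (simp only: right_minus_eq)
    show "?G m1 m2 m3 * (\<Sum>t\<in>V. echar (t \<cdot> (m1 - (m2 + m2) + m3)))
        = (if m3 = m2 + m2 - m1 then ?G m1 m2 m3 * of_real F else 0)"
      unfolding sum_echar[OF V] iff by (cases "m3 = m2 + m2 - m1") simp_all
  qed
  also have "\<dots> = (\<Sum>m1\<in>V. \<Sum>m2\<in>V. ?G m1 m2 (m2 + m2 - m1) * of_real F)"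
    by (intro sum.cong refl) (simp add: finite_V V_diff V_add)
  also have "\<dots> = (\<Sum>m1\<in>V. \<Sum>d\<in>V. ?G m1 (m1 + d) (m1 + d + d) * of_real F)"
  proof (rule sum.cong[OF refl])
    fix m1 assume "m1 \<in> V"
    have "m1 + d + (m1 + d) - m1 = m1 + d + d" for d
      by (simp add: algebra_simps)
    then show "(\<Sum>m2\<in>V. ?G m1 m2 (m2 + m2 - m1) * of_real F)
        = (\<Sum>d\<in>V. ?G m1 (m1 + d) (m1 + d + d) * of_real F)"
      using sum_translate[OF \<open>m1 \<in> V\<close>, of "\<lambda>m2. ?G m1 m2 (m2 + m2 - m1) * of_real F"] by simp
  qed
  also have "\<dots> = of_real F * twisted_ap3 g x y z"
    by (simp add: twisted_ap3_def sum_distrib_left mult_ac)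
  finally show ?thesis .
qed


lemma double_eq_scale: "t + t = 2 *s t"
  using scale_left_distrib[of 1 1 t] by (simp only: one_add_one scale_one)

lemma double_in_subspace_iff:
  assumes "odd CARD('p)" "subspace U"
  shows "t + t \<in> U \<longleftrightarrow> t \<in> U"
proof
  assume "t + t \<in> U"
  then have "inverse 2 *s (2 *s t) \<in> U"
    using subspace_scale[OF assms(2)] by (simp only: double_eq_scale)
  then show "t \<in> U"
    using two_neq_0_mod_ring[OF assms(1)] by simp
qed (rule subspace_add[OF assms(2)])

text \<open>
  In odd characteristic the middle frequency \<open>y - 2t\<close> runs through the whole space once, so that the
  Parseval identity applies to it as well.
\<close>

lemma bij_minus_double:
  assumes "odd CARD('p)" "y \<in> V"
  shows "bij_betw (\<lambda>t. y - (t + t)) V V"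
  by (rule bij_betw_byWitness[where f' = "\<lambda>s. inverse 2 *s (y - s)"])
    (use two_neq_0_mod_ring[OF assms(1)] assms(2) in
      \<open>auto simp: double_eq_scale intro!: V_diff V_scale\<close>)

section \<open>Unique triples of large coefficients\<close>

text \<open>
  The function lives on one coset of the orthogonal complement of \<open>U\<close>. This form mentions neither
  the complement nor a base point.
\<close>

definition coset_supported :: "'v set \<Rightarrow> ('v \<Rightarrow> real) \<Rightarrow> bool" where
  "coset_supported U g \<longleftrightarrow>
     (\<forall>u\<in>U. \<forall>m\<in>V. \<forall>m'\<in>V. g m \<noteq> 0 \<longrightarrow> g m' \<noteq> 0 \<longrightarrow> u \<cdot> m = u \<cdot> m')"

definition spectrum_within :: "('v \<Rightarrow> real) \<Rightarrow> real \<Rightarrow> 'v set \<Rightarrow> 'v set \<Rightarrow> bool" where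
  "spectrum_within g \<eta> X U \<longleftrightarrow> (\<forall>a\<in>V. norm (ft g a) > \<eta> \<longrightarrow> (\<exists>x\<in>X. a - x \<in> U))"

text \<open>
  Characters from \<open>U\<close> are constant on the support, hence shifting a frequency by \<open>u \<in> U\<close> only
  multiplies the coefficient by a phase, which is a character of \<open>u\<close>. In particular the phases cancel along
  \<open>(t, -2t, t)\<close>.
\<close>

lemma coset_supported_ft:
  assumes "coset_supported U g"
  obtains c where "\<And>u x. u \<in> U \<Longrightarrow> ft g (x + u) = echar (u \<cdot> c) * ft g x"
proof (cases "\<exists>c\<in>V. g c \<noteq> 0")
  case True
  then obtain c where c: "c \<in> V" "g c \<noteq> 0" by blast
  have "ft g (x + u) = echar (u \<cdot> c) * ft g x" if "u \<in> U" for u x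
    unfolding ft_def sum_distrib_left
  proof (rule sum.cong[OF refl])
    fix m assume "m \<in> V"
    show "of_real (g m) * echar ((x + u) \<cdot> m) = echar (u \<cdot> c) * (of_real (g m) * echar (x \<cdot> m))"
    proof (cases "g m = 0")
      case False
      then have "u \<cdot> m = u \<cdot> c"
        using assms c \<open>m \<in> V\<close> \<open>u \<in> U\<close> unfolding coset_supported_def by blast
      then show ?thesis by (simp only: dot_add_left echar_add mult_ac)
    qed simp
  qed
  then show ?thesis using that by blast
next
  case False
  then have "ft g x = 0" for x
    unfolding ft_def by (intro sum.neutral) simp
  then show ?thesis using that by simp
qed

text \<open>
  In the sum over \<open>t\<close>, the terms with \<open>t \<in> U\<close> all equal the term \<open>t = 0\<close>. If no \<open>t \<notin> U\<close> keeps all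
  three frequencies in \<open>X + U\<close>, every other term has a factor of size at most \<open>\<eta>\<close>, and the remaining two
  factors are summed by the Parseval identity.
\<close>

lemma unique_triple_bound:
  assumes odd: "odd CARD('p)"
    and U: "subspace U" "U \<subseteq> V"
    and g: "coset_supported U g" "\<And>m. m \<in> V \<Longrightarrow> 0 \<le> g m" "\<And>m. m \<in> V \<Longrightarrow> g m \<le> 1"
    and spec: "spectrum_within g \<eta> X U" "0 \<le> \<eta>"
    and xyz: "x \<in> V" "y \<in> V" "z \<in> V"
    and uniq: "\<And>t. t \<in> V - U \<Longrightarrow> \<not> ((\<exists>w\<in>X. x + t - w \<in> U) \<and> (\<exists>w\<in>X. y - (t + t) - w \<in> U)
                \<and> (\<exists>w\<in>X. z + t - w \<in> U))"
  shows "norm (ft g x) * norm (ft g y) * norm (ft g z) \<le> F * ap3 g + 3 * \<eta> * F * (\<Sum>m\<in>V. g m)"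
proof -
  obtain c where c: "\<And>u x. u \<in> U \<Longrightarrow> ft g (x + u) = echar (u \<cdot> c) * ft g x"
    using coset_supported_ft[OF g(1)] by blast
  let ?T = "\<lambda>t. ft g (x + t) * ft g (y - (t + t)) * ft g (z + t)"
  \<comment> \<open>the phases at t, -2t, t multiply to 1\<close>
  have on_U: "?T t = ft g x * ft g y * ft g z" if "t \<in> U" for t
  proof -
    have "- (t + t) \<in> U" using U(1) that by (intro subspace_neg subspace_add)
    from c[OF this, of y] have y: "ft g (y - (t + t)) = echar (- (t + t) \<cdot> c) * ft g y"
      by (simp only: diff_conv_add_uminus)
    have "echar (t \<cdot> c) * echar (- (t + t) \<cdot> c) * echar (t \<cdot> c) = 1"
      unfolding echar_add[symmetric] dot_add_left[symmetric] by simp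
    then have "(echar (t \<cdot> c) * echar (- (t + t) \<cdot> c) * echar (t \<cdot> c)) * (ft g x * ft g y * ft g z)
        = ft g x * ft g y * ft g z" by (simp only: mult_1)
    then show ?thesis
      unfolding c[OF that] y by (simp only: mult_ac)
  qed
  have finU: "finite U" using U(2) finite_V finite_subset by blast
  have cardU: "1 \<le> real (card U)"
  proof -
    have "card U > 0" using finU subspace_0[OF U(1)] card_gt_0_iff by blast
    then show ?thesis by linarith
  qed
  define E where "E t = (norm (ft g (x + t)))\<^sup>2 + (norm (ft g (y - (t + t))))\<^sup>2 + (norm (ft g (z + t)))\<^sup>2" for t
  \<comment> \<open>one factor is at most \<open>\<eta>\<close>; the product of the other two is bounded by their squares\<close>
  have off_U: "norm (?T t) \<le> \<eta> * E t" if "t \<in> V - U" for t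
  proof -
    let ?a = "norm (ft g (x + t))" and ?b = "norm (ft g (y - (t + t)))" and ?c = "norm (ft g (z + t))"
    have V: "x + t \<in> V" "y - (t + t) \<in> V" "z + t \<in> V"
      using that xyz by (auto intro!: V_add V_diff)
    have ab: "?a * ?b \<le> E t" "?b * ?c \<le> E t" "?a * ?c \<le> E t"
    proof -
      have *: "r * s \<le> r\<^sup>2 + s\<^sup>2" for r s :: real
        using sum_squares_bound[of r s] zero_le_power2[of r] zero_le_power2[of s] by linarith
      show "?a * ?b \<le> E t" "?b * ?c \<le> E t" "?a * ?c \<le> E t"
        unfolding E_def using *[of ?a ?b] *[of ?b ?c] *[of ?a ?c]
          zero_le_power2[of ?a] zero_le_power2[of ?b] zero_le_power2[of ?c] by linarith+
    qed
    have "?a \<le> \<eta> \<or> ?b \<le> \<eta> \<or> ?c \<le> \<eta>"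
      using uniq[OF that] spec(1) V unfolding spectrum_within_def by (meson not_le)
    then have "?a * ?b * ?c \<le> \<eta> * E t"
    proof (elim disjE)
      assume "?a \<le> \<eta>"
      then have "?a * (?b * ?c) \<le> \<eta> * E t" by (intro mult_mono ab spec(2)) auto
      then show ?thesis by (simp only: mult.assoc)
    next
      assume "?b \<le> \<eta>"
      then have "?b * (?a * ?c) \<le> \<eta> * E t" by (intro mult_mono ab spec(2)) auto
      then show ?thesis by (simp only: mult_ac)
    next
      assume "?c \<le> \<eta>"
      then have "?c * (?a * ?b) \<le> \<eta> * E t" by (intro mult_mono ab spec(2)) auto
      then show ?thesis by (simp only: mult_ac)
    qed
    then show ?thesis by (simp only: norm_mult)
  qed
  let ?Q = "\<Sum>a\<in>V. (norm (ft g a))\<^sup>2"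
  have sumE: "(\<Sum>t\<in>V. E t) = 3 * ?Q"
    unfolding E_def sum.distrib
    using sum_translate[OF xyz(1), of "\<lambda>a. (norm (ft g a))\<^sup>2"]
      sum_translate[OF xyz(3), of "\<lambda>a. (norm (ft g a))\<^sup>2"]
      sum.reindex_bij_betw[OF bij_minus_double[OF odd xyz(2)], of "\<lambda>a. (norm (ft g a))\<^sup>2"]
    by linarith
  have "(\<Sum>m\<in>V. (g m)\<^sup>2) \<le> (\<Sum>m\<in>V. g m)"
  proof (rule sum_mono)
    fix m assume "m \<in> V"
    then show "(g m)\<^sup>2 \<le> g m"
      using mult_left_mono[OF g(3) g(2), of m m] by (simp only: power2_eq_square mult_1_right)
  qed
  then have Q: "?Q \<le> F * (\<Sum>m\<in>V. g m)"
    unfolding parseval by (intro mult_left_mono) auto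
  have "norm (\<Sum>t\<in>V-U. ?T t) \<le> (\<Sum>t\<in>V-U. \<eta> * E t)"
    by (intro sum_norm_le off_U)
  also have "\<dots> \<le> (\<Sum>t\<in>V. \<eta> * E t)"
    by (rule sum_mono2) (use finite_V spec(2) in \<open>auto simp: E_def\<close>)
  also have "\<dots> = \<eta> * (3 * ?Q)"
    by (simp only: sum_distrib_left[symmetric] sumE)
  also have "\<dots> \<le> \<eta> * (3 * (F * (\<Sum>m\<in>V. g m)))"
    using Q spec(2) by (intro mult_left_mono) auto
  finally have tail: "norm (\<Sum>t\<in>V-U. ?T t) \<le> 3 * \<eta> * F * (\<Sum>m\<in>V. g m)"
    by (simp only: mult_ac)
  have "(\<Sum>t\<in>U. ?T t) = of_nat (card U) * (ft g x * ft g y * ft g z)"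
    using on_U by simp
  moreover have "(\<Sum>t\<in>V. ?T t) = (\<Sum>t\<in>V-U. ?T t) + (\<Sum>t\<in>U. ?T t)"
    by (rule sum.subset_diff[OF U(2) finite_V])
  ultimately have eq: "of_nat (card U) * (ft g x * ft g y * ft g z)
      = of_real F * twisted_ap3 g x y z - (\<Sum>t\<in>V-U. ?T t)"
    by (simp add: sum_ft_triple)
  let ?P = "norm (ft g x) * norm (ft g y) * norm (ft g z)"
  have "?P \<le> real (card U) * ?P"
    using mult_right_mono[OF cardU, of ?P] by simp
  also have "\<dots> = norm (of_real F * twisted_ap3 g x y z - (\<Sum>t\<in>V-U. ?T t))"
    unfolding eq[symmetric] by (simp add: norm_mult)
  also have "\<dots> \<le> norm (of_real F * twisted_ap3 g x y z) + norm (\<Sum>t\<in>V-U. ?T t)"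
    by (rule norm_triangle_ineq4)
  also have "norm (of_real F * twisted_ap3 g x y z) \<le> F * ap3 g"
    using norm_twisted_ap3_le[of g x y z] g(2) by (simp add: norm_mult mult_left_mono)
  finally show ?thesis using tail by linarith
qed

section \<open>Restricting to cosets until no difference is popular\<close>

text \<open>
  The function splits into \<open>p\<close> slices according to the value of \<open>t \<cdot> m\<close>, and one of them carries at
  least the average mass. A coefficient of a slice is an average of coefficients of \<open>g\<close> along the line
  in direction \<open>t\<close>, twisted by phases, so it is large only if that line meets the large spectrum.
\<close>

lemma slice_exists:
  assumes U: "subspace U" and t: "t \<in> V"
    and g: "coset_supported U g" "\<And>m. m \<in> V \<Longrightarrow> 0 \<le> g m"
    and spec: "spectrum_within g \<eta> X U"
  obtains g' where "coset_supported (span (insert t U)) g'"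
    "\<And>m. m \<in> V \<Longrightarrow> 0 \<le> g' m" "\<And>m. m \<in> V \<Longrightarrow> g' m \<le> g m"
    "(\<Sum>m\<in>V. g m) \<le> real CARD('p) * (\<Sum>m\<in>V. g' m)"
    "spectrum_within g' \<eta> X (span (insert t U))"
proof -
  let ?U = "span (insert t U)"
  define slice where "slice s m = (if t \<cdot> m = s then g m else 0)" for s m
  have "(\<Sum>s\<in>UNIV. \<Sum>m\<in>V. slice s m) = (\<Sum>m\<in>V. \<Sum>s\<in>UNIV. slice s m)"
    by (rule sum.swap)
  also have "\<dots> = (\<Sum>m\<in>V. g m)"
    by (simp add: slice_def)
  finally have total: "(\<Sum>s\<in>UNIV. \<Sum>m\<in>V. slice s m) = (\<Sum>m\<in>V. g m)" .
  have "\<exists>s. (\<Sum>m\<in>V. g m) \<le> real CARD('p) * (\<Sum>m\<in>V. slice s m)"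
  proof (rule ccontr)
    assume "\<not> ?thesis"
    then have "real CARD('p) * (\<Sum>m\<in>V. slice s m) < (\<Sum>m\<in>V. g m)" for s
      by (meson not_le)
    then have "(\<Sum>s\<in>UNIV. real CARD('p) * (\<Sum>m\<in>V. slice s m)) < (\<Sum>s\<in>(UNIV::'p mod_ring set). \<Sum>m\<in>V. g m)"
      by (intro sum_strict_mono) auto
    then show False
      unfolding sum_distrib_left[symmetric] total by simp
  qed
  then obtain s where s: "(\<Sum>m\<in>V. g m) \<le> real CARD('p) * (\<Sum>m\<in>V. slice s m)" ..
  have "coset_supported ?U (slice s)"
    unfolding coset_supported_def
  proof (intro ballI impI)
    fix u m m' assume "u \<in> ?U" and V: "m \<in> V" "m' \<in> V" and nz: "slice s m \<noteq> 0" "slice s m' \<noteq> 0"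
    then obtain k where k: "u - k *s t \<in> U"
      unfolding span_breakdown_eq using U by (auto simp: span_eq_iff[THEN iffD2])
    from nz have tm: "t \<cdot> m = s" "g m \<noteq> 0" "t \<cdot> m' = s" "g m' \<noteq> 0"
      by (auto simp: slice_def split: if_splits)
    have "(u - k *s t) \<cdot> m = (u - k *s t) \<cdot> m'"
      using g(1) k V tm unfolding coset_supported_def by blast
    then show "u \<cdot> m = u \<cdot> m'"
      by (simp add: dot_simps tm)
  qed
  moreover have "spectrum_within (slice s) \<eta> X ?U"
    unfolding spectrum_within_def
  proof (intro ballI impI)
    fix a assume "a \<in> V" and big: "\<eta> < norm (ft (slice s) a)"
    have "of_nat CARD('p) * ft (slice s) a = (\<Sum>k\<in>UNIV. echar (- (k * s)) * ft g (a + k *s t))"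
    proof -
      have "(\<Sum>k\<in>UNIV. echar (- (k * s)) * ft g (a + k *s t))
          = (\<Sum>k\<in>UNIV. \<Sum>m\<in>V. of_real (g m) * echar (a \<cdot> m) * echar (k * (t \<cdot> m - s)))"
      proof (rule sum.cong[OF refl])
        fix k
        have "echar (- (k * s)) * (of_real (g m) * echar ((a + k *s t) \<cdot> m))
            = of_real (g m) * echar (a \<cdot> m) * echar (k * (t \<cdot> m - s))" for m
        proof -
          have "- (k * s) + (a + k *s t) \<cdot> m = a \<cdot> m + k * (t \<cdot> m - s)"
            by (simp add: dot_simps algebra_simps)
          from arg_cong[OF this, of echar]
          have e: "echar (- (k * s)) * echar ((a + k *s t) \<cdot> m) = echar (a \<cdot> m) * echar (k * (t \<cdot> m - s))"
            by (simp only: echar_add)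
          have "echar (- (k * s)) * (of_real (g m) * echar ((a + k *s t) \<cdot> m))
              = of_real (g m) * (echar (- (k * s)) * echar ((a + k *s t) \<cdot> m))"
            by (simp only: mult_ac)
          then show ?thesis unfolding e by (simp only: mult.assoc)
        qed
        then show "echar (- (k * s)) * ft g (a + k *s t)
            = (\<Sum>m\<in>V. of_real (g m) * echar (a \<cdot> m) * echar (k * (t \<cdot> m - s)))"
          by (simp only: ft_def sum_distrib_left)
      qed
      also have "\<dots> = (\<Sum>m\<in>V. of_real (g m) * echar (a \<cdot> m) * (\<Sum>k\<in>UNIV. echar (k * (t \<cdot> m - s))))"
        unfolding sum_distrib_left by (rule sum.swap)
      also have "\<dots> = (\<Sum>m\<in>V. of_nat CARD('p) * (of_real (slice s m) * echar (a \<cdot> m)))"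
        by (intro sum.cong refl) (simp add: sum_echar_mult slice_def)
      also have "\<dots> = of_nat CARD('p) * ft (slice s) a"
        by (simp only: ft_def sum_distrib_left)
      finally show ?thesis by simp
    qed
    then have "real CARD('p) * norm (ft (slice s) a) = norm (\<Sum>k\<in>UNIV. echar (- (k * s)) * ft g (a + k *s t))"
      by (metis norm_mult norm_of_nat)
    also have "\<dots> \<le> (\<Sum>k\<in>UNIV. norm (ft g (a + k *s t)))"
      by (intro sum_norm_le) (simp add: norm_mult)
    finally have le: "real CARD('p) * norm (ft (slice s) a) \<le> (\<Sum>k\<in>UNIV. norm (ft g (a + k *s t)))" .
    have "\<exists>k. \<eta> < norm (ft g (a + k *s t))"
    proof (rule ccontr)
      assume "\<not> ?thesis"
      then have "(\<Sum>k\<in>UNIV. norm (ft g (a + k *s t))) \<le> (\<Sum>k\<in>(UNIV::'p mod_ring set). \<eta>)"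
        by (intro sum_mono) (meson not_le)
      also have "\<dots> = real CARD('p) * \<eta>" by simp
      finally have "real CARD('p) * norm (ft (slice s) a) \<le> real CARD('p) * \<eta>"
        using le by (rule order_trans[rotated])
      with big show False
        using card_field_gt_1 by (simp add: mult_le_cancel_left)
    qed
    then obtain k x where kx: "x \<in> X" "a + k *s t - x \<in> U"
      using spec \<open>a \<in> V\<close> t unfolding spectrum_within_def by (meson V_add V_scale)
    have "(a - x) - (- k) *s t \<in> span U"
      using kx(2) by (intro span_base) (simp add: algebra_simps)
    then have "a - x \<in> ?U" unfolding span_breakdown_eq by blast
    then show "\<exists>x\<in>X. a - x \<in> ?U" using kx(1) by blast
  qed
  moreover have "0 \<le> slice s m" "slice s m \<le> g m" if "m \<in> V" for m
    using g(2)[OF that] by (auto simp: slice_def)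
  ultimately show ?thesis using that s by blast
qed


text \<open>
  The elements that witness the popularity of the difference \<open>t\<close>.
\<close>

definition shift_stable :: "'v set \<Rightarrow> 'v set \<Rightarrow> 'v \<Rightarrow> 'v set" where
  "shift_stable U X t = {x \<in> X. \<exists>w\<in>X. x + t - w \<in> U}"

text \<open>
  An element \<open>x\<close> with \<open>x + t \<equiv> w\<close> modulo \<open>U\<close> falls together with \<open>w\<close> once \<open>t\<close> belongs to the
  subspace, and \<open>w \<noteq> x\<close> because \<open>t \<notin> U\<close>. So every class with such an element has at least two members, of which
  one representative survives: at least half as many elements disappear as there are witnesses.
\<close>

lemma merge_representatives:
  assumes "finite X" and U: "subspace U" and t: "t \<notin> U"
  obtains X' where "X' \<subseteq> X" "\<And>x. x \<in> X \<Longrightarrow> \<exists>x'\<in>X'. x - x' \<in> span (insert t U)"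
    "card (shift_stable U X t) \<le> 2 * (card X - card X')"
proof -
  let ?U = "span (insert t U)"
  \<comment> \<open>a representative of the class of x that depends on the class only\<close>
  define r where "r x = (SOME y. y \<in> X \<and> x - y \<in> ?U)" for x
  have r: "r x \<in> X \<and> x - r x \<in> ?U" if "x \<in> X" for x
    unfolding r_def by (rule someI[of _ x]) (simp add: that span_zero)
  have r_eq: "r x = r y" if "x - y \<in> ?U" for x y
  proof -
    have "x - z \<in> ?U \<longleftrightarrow> y - z \<in> ?U" for z
    proof
      assume "x - z \<in> ?U"
      from span_diff[OF this that] show "y - z \<in> ?U" by simp
    next
      assume "y - z \<in> ?U"
      from span_add[OF this that] show "x - z \<in> ?U" by simp
    qed
    then show ?thesis unfolding r_def by simp
  qed
  define X' where "X' = r ` X"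
  have sub: "X' \<subseteq> X" using r by (auto simp: X'_def)
  have r_id: "r x = x" if "x \<in> X'" for x
  proof -
    from that obtain y where "y \<in> X" "x = r y" by (auto simp: X'_def)
    then show ?thesis using r r_eq by metis
  qed
  let ?S = "shift_stable U X t"
  have "?S \<subseteq> (X - X') \<union> r ` (X - X')"
  proof
    fix x assume "x \<in> ?S"
    then obtain w where x: "x \<in> X" and w: "w \<in> X" "x + t - w \<in> U"
      by (auto simp: shift_stable_def)
    have "w \<noteq> x" using w(2) t by auto
    have "(x - w) - (- 1) *s t \<in> span U"
      using w(2) by (intro span_base) (simp add: algebra_simps)
    then have "x - w \<in> ?U" unfolding span_breakdown_eq by blast
    then have "r x = r w" by (rule r_eq)
    show "x \<in> (X - X') \<union> r ` (X - X')"
    proof (cases "x \<in> X'")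
      case True
      then have "x = r w" using r_id \<open>r x = r w\<close> by simp
      moreover have "w \<notin> X'" using r_id \<open>w \<noteq> x\<close> \<open>x = r w\<close> by metis
      ultimately show ?thesis using w(1) by blast
    qed (use x in blast)
  qed
  then have "card ?S \<le> card ((X - X') \<union> r ` (X - X'))"
    using assms(1) by (intro card_mono) auto
  also have "\<dots> \<le> card (X - X') + card (r ` (X - X'))" by (rule card_Un_le)
  also have "\<dots> \<le> card (X - X') + card (X - X')"
    using assms(1) by (intro add_left_mono card_image_le) auto
  also have "\<dots> = 2 * (card X - card X')"
    using card_Diff_subset[OF finite_subset[OF sub assms(1)] sub] by simp
  finally have "card ?S \<le> 2 * (card X - card X')" .
  moreover have "\<exists>x'\<in>X'. x - x' \<in> ?U" if "x \<in> X" for x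
    using r[OF that] that by (auto simp: X'_def)
  ultimately show ?thesis using that sub by blast
qed

text \<open>
  The quantity \<open>2 |X|\<close> pays for the steps: each of them uses up at least \<open>P\<close>.
\<close>

lemma remove_popular_differences:
  assumes "finite X" "subspace U" "U \<subseteq> V" "coset_supported U g"
    "\<And>m. m \<in> V \<Longrightarrow> 0 \<le> g m" "spectrum_within g \<eta> X U" "P > 0"
  shows "\<exists>U' X' g' h. subspace U' \<and> U' \<subseteq> V \<and> coset_supported U' g' \<and>
    (\<forall>m\<in>V. 0 \<le> g' m \<and> g' m \<le> g m) \<and> (\<Sum>m\<in>V. g m) \<le> real CARD('p) ^ h * (\<Sum>m\<in>V. g' m) \<and>
    X' \<subseteq> X \<and> spectrum_within g' \<eta> X' U' \<and> h * P \<le> 2 * card X \<and>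
    (\<forall>t\<in>V - U'. card (shift_stable U' X' t) < P)"
  using assms
proof (induction "card X" arbitrary: X U g rule: less_induct)
  case less
  show ?case
  proof (cases "\<forall>t\<in>V - U. card (shift_stable U X t) < P")
    case True
    then show ?thesis
      using less.prems by (intro exI[of _ U] exI[of _ X] exI[of _ g] exI[of _ 0]) auto
  next
    case False
    then obtain t where t: "t \<in> V" "t \<notin> U" "P \<le> card (shift_stable U X t)"
      by (auto simp: not_less)
    let ?U = "span (insert t U)"
    obtain X' where X': "X' \<subseteq> X" "\<And>x. x \<in> X \<Longrightarrow> \<exists>x'\<in>X'. x - x' \<in> ?U"
      "card (shift_stable U X t) \<le> 2 * (card X - card X')"
      using merge_representatives[OF less.prems(1,2) t(2)] by blast
    obtain g' where g': "coset_supported ?U g'"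
      "\<And>m. m \<in> V \<Longrightarrow> 0 \<le> g' m" "\<And>m. m \<in> V \<Longrightarrow> g' m \<le> g m"
      "(\<Sum>m\<in>V. g m) \<le> real CARD('p) * (\<Sum>m\<in>V. g' m)" "spectrum_within g' \<eta> X ?U"
      using slice_exists[OF less.prems(2) t(1) less.prems(4,5,6)] by blast
    have "spectrum_within g' \<eta> X' ?U"
      unfolding spectrum_within_def
    proof (intro ballI impI)
      fix a assume "a \<in> V" "\<eta> < norm (ft g' a)"
      then obtain x where x: "x \<in> X" "a - x \<in> ?U"
        using g'(5) unfolding spectrum_within_def by blast
      then obtain x' where "x' \<in> X'" "x - x' \<in> ?U" using X'(2) by blast
      then show "\<exists>x\<in>X'. a - x \<in> ?U"
        using span_add[OF x(2), of "x - x'"] by auto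
    qed
    moreover have "card X' < card X"
      using t(3) X'(3) less.prems(7) by linarith
    moreover have "?U \<subseteq> V"
      using t(1) less.prems(3) by (intro span_minimal subspace_V) auto
    moreover have "finite X'" using X'(1) less.prems(1) finite_subset by blast
    ultimately obtain U'' X'' g'' h where IH: "subspace U''" "U'' \<subseteq> V" "coset_supported U'' g''"
      "\<forall>m\<in>V. 0 \<le> g'' m \<and> g'' m \<le> g' m" "(\<Sum>m\<in>V. g' m) \<le> real CARD('p) ^ h * (\<Sum>m\<in>V. g'' m)"
      "X'' \<subseteq> X'" "spectrum_within g'' \<eta> X'' U''" "h * P \<le> 2 * card X'"
      "\<forall>t\<in>V - U''. card (shift_stable U'' X'' t) < P"
      using less.hyps[of X' ?U g'] g'(1,2) less.prems(7) by auto
    have "(\<Sum>m\<in>V. g m) \<le> real CARD('p) * (real CARD('p) ^ h * (\<Sum>m\<in>V. g'' m))"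
      by (rule order_trans[OF g'(4)], rule mult_left_mono[OF IH(5)]) simp
    then have mass: "(\<Sum>m\<in>V. g m) \<le> real CARD('p) ^ Suc h * (\<Sum>m\<in>V. g'' m)"
      by (simp add: mult.assoc)
    have "P + h * P \<le> 2 * card X"
      using IH(8) t(3) X'(3) \<open>card X' < card X\<close> by linarith
    then have steps: "Suc h * P \<le> 2 * card X" by simp
    have "\<forall>m\<in>V. 0 \<le> g'' m \<and> g'' m \<le> g m"
      using IH(4) g'(3) by force
    then show ?thesis
      using IH mass steps X'(1)
      by (intro exI[of _ U''] exI[of _ X''] exI[of _ g''] exI[of _ "Suc h"]) auto
  qed
qed

text \<open>
  A shift \<open>t\<close> that works for \<open>(x, y, z)\<close> sends \<open>x\<close> to some \<open>w \<in> X\<close> modulo \<open>U\<close>, so up to \<open>U\<close> it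
  is the difference \<open>w - x\<close>. For given \<open>x\<close> and \<open>w\<close>, the entry \<open>z\<close> witnesses the popularity of \<open>t\<close>
  and \<open>y\<close> that of \<open>-2t\<close>, which lies outside \<open>U\<close> too since \<open>p\<close> is odd.
\<close>

lemma card_cube_le_of_shifted_triples:
  assumes odd: "odd CARD('p)" and U: "subspace U" and X: "finite X" "X \<subseteq> V" and Y: "Y \<subseteq> X"
    and unpop: "\<And>t. t \<in> V - U \<Longrightarrow> card (shift_stable U X t) < P"
    and triples: "\<And>x y z. x \<in> Y \<Longrightarrow> y \<in> Y \<Longrightarrow> z \<in> Y \<Longrightarrow> \<exists>t\<in>V - U. (\<exists>w\<in>X. x + t - w \<in> U) \<and>
        (\<exists>w\<in>X. y - (t + t) - w \<in> U) \<and> (\<exists>w\<in>X. z + t - w \<in> U)"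
  shows "card Y ^ 3 \<le> card Y * card X * (P - 1)\<^sup>2"
proof -
  define I where "I = {(x, w). x \<in> Y \<and> w \<in> X \<and> w - x \<notin> U}"
  define B where "B xw = (case xw of (x, w) \<Rightarrow>
      {x} \<times> shift_stable U X (- ((w - x) + (w - x))) \<times> shift_stable U X (w - x))" for xw
  have finY: "finite Y" using Y X(1) finite_subset by blast
  have Isub: "I \<subseteq> Y \<times> X" unfolding I_def by auto
  have finI: "finite I" using Isub finY X(1) finite_subset by blast
  have cover: "Y \<times> Y \<times> Y \<subseteq> (\<Union>xw\<in>I. B xw)"
  proof
    fix v assume "v \<in> Y \<times> Y \<times> Y"
    then obtain x y z where v: "v = (x, y, z)" and Y': "x \<in> Y" "y \<in> Y" "z \<in> Y" by auto
    obtain t w w2 w3 where t: "t \<in> V" "t \<notin> U" and w: "w \<in> X" "x + t - w \<in> U"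
      and w2: "w2 \<in> X" "y - (t + t) - w2 \<in> U" and w3: "w3 \<in> X" "z + t - w3 \<in> U"
      using triples[OF Y'] by blast
    have "w - x \<notin> U"
    proof
      assume "w - x \<in> U"
      from subspace_add[OF U w(2) this] t(2) show False by simp
    qed
    then have "(x, w) \<in> I" using Y'(1) w(1) by (simp add: I_def)
    moreover have "z + (w - x) - w3 \<in> U"
      using subspace_diff[OF U w3(2) w(2)] by (simp add: algebra_simps)
    then have "z \<in> shift_stable U X (w - x)"
      using Y'(3) Y w3(1) by (auto simp: shift_stable_def)
    moreover have "y - (t + t) - w2 + ((x + t - w) + (x + t - w)) \<in> U"
      by (intro subspace_add[OF U] w2(2) w(2))
    then have "y + - ((w - x) + (w - x)) - w2 \<in> U" by (simp add: algebra_simps)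
    then have "y \<in> shift_stable U X (- ((w - x) + (w - x)))"
      using Y'(2) Y w2(1) by (auto simp: shift_stable_def)
    ultimately show "v \<in> (\<Union>xw\<in>I. B xw)"
      unfolding v B_def by force
  qed
  have cardB: "card (B xw) \<le> (P - 1)\<^sup>2" if "xw \<in> I" for xw
  proof -
    obtain x w where xw: "xw = (x, w)" by fastforce
    then have w: "x \<in> Y" "w \<in> X" "w - x \<notin> U" using that by (auto simp: I_def)
    then have V: "w - x \<in> V" using X(2) Y by (intro V_diff) auto
    have "- ((w - x) + (w - x)) \<notin> U"
      using w(3) double_in_subspace_iff[OF odd U, of "w - x"] subspace_neg[OF U] by force
    moreover have "- ((w - x) + (w - x)) \<in> V" using V by (intro V_neg V_add)
    ultimately have "card (shift_stable U X (- ((w - x) + (w - x)))) \<le> P - 1"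
      using unpop[of "- ((w - x) + (w - x))"] by simp
    moreover have "card (shift_stable U X (w - x)) \<le> P - 1"
      using unpop[of "w - x"] V w(3) by simp
    ultimately show ?thesis
      unfolding xw B_def by (simp add: card_cartesian_product power2_eq_square mult_le_mono)
  qed
  have finB: "finite (\<Union>xw\<in>I. B xw)"
    using finI X(1) by (auto simp: B_def shift_stable_def)
  have "card Y ^ 3 = card (Y \<times> Y \<times> Y)"
    by (simp add: card_cartesian_product power3_eq_cube)
  also have "\<dots> \<le> card (\<Union>xw\<in>I. B xw)" by (rule card_mono[OF finB cover])
  also have "\<dots> \<le> (\<Sum>xw\<in>I. card (B xw))" by (rule card_UN_le[OF finI])
  also have "\<dots> \<le> card I * (P - 1)\<^sup>2"
    using sum_bounded_above[of I "\<lambda>xw. card (B xw)" "(P - 1)\<^sup>2"] cardB by simp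
  also have "\<dots> \<le> card Y * card X * (P - 1)\<^sup>2"
    using card_mono[OF _ Isub] finY X(1) by (intro mult_le_mono1) (simp add: card_cartesian_product)
  finally show ?thesis .
qed


section \<open>Iterating the loss of spectrum\<close>

lemma norm_ft_coset:
  assumes "coset_supported U g" "a - x \<in> U"
  shows "norm (ft g a) = norm (ft g x)"
proof -
  obtain c where "\<And>u x. u \<in> U \<Longrightarrow> ft g (x + u) = echar (u \<cdot> c) * ft g x"
    using coset_supported_ft[OF assms(1)] by blast
  from this[OF assms(2), of x] show ?thesis by (simp add: norm_mult)
qed

text \<open>
  One round of the iteration. Thresholds are relative to the mass of the current function: off
  \<open>X + U\<close> the coefficients are at most \<open>\<nu>\<^sup>4\<close> times the mass, and \<open>Y\<close> collects those above \<open>\<nu>\<close>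
  times the new mass. Three of the latter multiply to more than \<open>\<nu>\<^sup>3\<close>, whereas a unique triple would
  allow only \<open>O(\<nu>\<^sup>4)\<close>, with four times the cube of \<open>p\<^sup>R / \<theta>\<close> as the constant, \<open>R\<close> being a
  bound for the number of slicings in all rounds. The bound \<open>\<nu>\<^sup>4 F \<ge> 1\<close> makes the
  contribution of \<open>ap3 f \<le> \<theta> F\<close> equally small.
\<close>

lemma spectrum_shrinks:
  fixes R r P H :: nat and \<theta> \<nu> :: real
  assumes odd: "odd CARD('p)"
    and \<theta>: "0 < \<theta>" "\<theta> \<le> 1"
    and f: "\<And>m. m \<in> V \<Longrightarrow> 0 \<le> f m" "\<And>m. m \<in> V \<Longrightarrow> f m \<le> 1" "ap3 f \<le> \<theta> * F"
    and X: "finite X" "X \<subseteq> V" and U: "subspace U" "U \<subseteq> V"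
    and g: "coset_supported U g" "\<And>m. m \<in> V \<Longrightarrow> 0 \<le> g m" "\<And>m. m \<in> V \<Longrightarrow> g m \<le> f m"
    and mass: "\<theta> * F \<le> real CARD('p) ^ r * (\<Sum>m\<in>V. g m)"
    and spec: "spectrum_within g (\<nu> ^ 4 * (\<Sum>m\<in>V. g m)) X U"
    and \<nu>: "0 < \<nu>" "4 * (real CARD('p) ^ R / \<theta>) ^ 3 * \<nu> \<le> 1" "1 \<le> \<nu> ^ 4 * F"
    and P: "P > 0" "2 * card X \<le> H * P" and R: "r + H \<le> R"
  obtains U' Y g' where "subspace U'" "U' \<subseteq> V" "coset_supported U' g'"
    "\<forall>m\<in>V. 0 \<le> g' m \<and> g' m \<le> f m"
    "\<theta> * F \<le> real CARD('p) ^ (r + H) * (\<Sum>m\<in>V. g' m)"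
    "Y \<subseteq> X" "spectrum_within g' (\<nu> * (\<Sum>m\<in>V. g' m)) Y U'"
    "0 < card Y" "(card Y)\<^sup>2 \<le> card X * (P - 1)\<^sup>2"
proof -
  let ?M = "\<Sum>m\<in>V. g m"
  let ?\<eta> = "\<nu> ^ 4 * ?M"
  obtain U' X' g' h where S: "subspace U'" "U' \<subseteq> V" "coset_supported U' g'"
    "\<forall>m\<in>V. 0 \<le> g' m \<and> g' m \<le> g m" "?M \<le> real CARD('p) ^ h * (\<Sum>m\<in>V. g' m)"
    "X' \<subseteq> X" "spectrum_within g' ?\<eta> X' U'" "h * P \<le> 2 * card X"
    "\<forall>t\<in>V - U'. card (shift_stable U' X' t) < P"
    using remove_popular_differences[OF X(1) U g(1,2) spec P(1)] by blast
  define M where "M = (\<Sum>m\<in>V. g' m)"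
  define Z where "Z = real CARD('p) ^ R / \<theta>"
  have p1: "1 \<le> real CARD('p)" using card_field_gt_1 by simp
  have "h * P \<le> H * P" using S(8) P(2) by linarith
  then have hH: "h \<le> H" using P(1) by simp
  have g'0: "\<And>m. m \<in> V \<Longrightarrow> 0 \<le> g' m" and g'f: "\<And>m. m \<in> V \<Longrightarrow> g' m \<le> f m"
    using S(4) g(3) by force+
  have M0: "0 \<le> M" unfolding M_def by (intro sum_nonneg g'0)
  have "\<theta> * F \<le> real CARD('p) ^ r * (real CARD('p) ^ h * M)"
    unfolding M_def by (rule order_trans[OF mass], rule mult_left_mono[OF S(5)]) simp
  also have "\<dots> = real CARD('p) ^ (r + h) * M" by (simp add: power_add)
  finally have mass_h: "\<theta> * F \<le> real CARD('p) ^ (r + h) * M" .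
  also have "\<dots> \<le> real CARD('p) ^ (r + H) * M"
    using hH p1 M0 by (intro mult_right_mono power_increasing) auto
  finally have mass': "\<theta> * F \<le> real CARD('p) ^ (r + H) * M" .
  also have "\<dots> \<le> real CARD('p) ^ R * M"
    using R p1 M0 by (intro mult_right_mono power_increasing) auto
  finally have FZ: "F \<le> Z * M"
    using \<theta>(1) unfolding Z_def by (simp add: field_simps)
  have pR: "1 \<le> real CARD('p) ^ R" using p1 by simp
  have pRZ: "real CARD('p) ^ R \<le> Z"
    unfolding Z_def using \<theta> pR by (simp add: le_divide_eq mult_left_le)
  then have Z1: "1 \<le> Z" using pR by linarith
  have ph: "real CARD('p) ^ h \<le> Z"
    using power_increasing[of h R "real CARD('p)"] hH R p1 pRZ by linarith
  have Mpos: "0 < M"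
  proof (rule ccontr)
    assume "\<not> 0 < M"
    with M0 have "M = 0" by simp
    with FZ F_ge_1 show False by simp
  qed
  have Z3: "Z ^ 3 * \<nu> \<le> 1 / 4" using \<nu>(2) unfolding Z_def by simp
  have ZZ3: "Z \<le> Z ^ 3" "Z\<^sup>2 \<le> Z ^ 3" "1 \<le> Z ^ 3"
    using power_increasing[of 1 3 Z] power_increasing[of 2 3 Z] power_increasing[of 0 3 Z] Z1 by auto
  have \<nu>4: "\<nu> \<le> 1 / 4"
    using mult_right_mono[OF ZZ3(3), of \<nu>] Z3 \<nu>(1) by linarith
  have \<eta>Z: "?\<eta> \<le> \<nu> ^ 4 * (Z * M)"
  proof (rule mult_left_mono)
    show "?M \<le> Z * M"
      using S(5) mult_right_mono[OF ph M0] unfolding M_def by linarith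
  qed (use \<nu>(1) in simp)
  have \<eta>0: "0 \<le> ?\<eta>" using \<nu>(1) g(2) by (intro mult_nonneg_nonneg sum_nonneg) auto
  \<comment> \<open>the frequencies above the new threshold are above the old one, hence covered by \<open>X' + U'\<close>\<close>
  have \<eta>\<nu>: "?\<eta> \<le> \<nu> * M"
  proof -
    have "\<nu> ^ 3 \<le> 1" using \<nu>(1) \<nu>4 by (intro power_le_one) auto
    have "Z * \<nu> \<le> Z ^ 3 * \<nu>" using ZZ3(1) \<nu>(1) by (intro mult_right_mono) auto
    then have "Z * \<nu> \<le> 1" using Z3 by linarith
    have "\<nu>\<^sup>2 \<le> 1" using \<nu>(1) \<nu>4 by (intro power_le_one) auto
    have "\<nu> ^ 4 * (Z * M) = (\<nu>\<^sup>2 * (Z * \<nu>)) * (\<nu> * M)"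
      by (simp add: power4_eq_xxxx power2_eq_square mult_ac)
    also have "\<dots> \<le> 1 * (\<nu> * M)"
    proof (rule mult_right_mono)
      show "\<nu>\<^sup>2 * (Z * \<nu>) \<le> 1"
        using \<nu>(1) Z1 by (intro mult_le_one[OF \<open>\<nu>\<^sup>2 \<le> 1\<close> _ \<open>Z * \<nu> \<le> 1\<close>]) simp
    qed (use \<nu>(1) M0 in simp)
    finally show ?thesis using \<eta>Z by linarith
  qed
  define Y where "Y = {x \<in> X'. norm (ft g' x) > \<nu> * M}"
  have YX: "Y \<subseteq> X'" unfolding Y_def by auto
  have specY: "spectrum_within g' (\<nu> * M) Y U'"
    unfolding spectrum_within_def
  proof (intro ballI impI)
    fix a assume a: "a \<in> V" "\<nu> * M < norm (ft g' a)"
    then obtain x where x: "x \<in> X'" "a - x \<in> U'"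
      using S(7) \<eta>\<nu> unfolding spectrum_within_def by force
    then have "x \<in> Y"
      using a(2) norm_ft_coset[OF S(3) x(2)] by (simp add: Y_def)
    then show "\<exists>x\<in>Y. a - x \<in> U'" using x(2) by blast
  qed
  have "norm (ft g' 0) = M" using M0 unfolding ft_0 M_def norm_of_real by (rule abs_of_nonneg)
  moreover have "\<nu> * M < M" using \<nu>4 Mpos by simp
  \<comment> \<open>the coefficient at 0 is the whole mass, so 0 always survives\<close>
  ultimately have "\<nu> * M < norm (ft g' 0)" by linarith
  then have "\<exists>x\<in>Y. 0 - x \<in> U'" using specY V_0 unfolding spectrum_within_def by blast
  then have "Y \<noteq> {}" by blast
  have finX': "finite X'" by (rule finite_subset[OF S(6) X(1)])
  have finY: "finite Y" by (rule finite_subset[OF YX finX'])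
  with \<open>Y \<noteq> {}\<close> have cardY: "0 < card Y" by (simp add: card_gt_0_iff)
  have X'V: "X' \<subseteq> V" using S(6) X(2) by blast
  have triples: "\<exists>t\<in>V - U'. (\<exists>w\<in>X'. x + t - w \<in> U') \<and> (\<exists>w\<in>X'. y - (t + t) - w \<in> U') \<and>
      (\<exists>w\<in>X'. z + t - w \<in> U')" if xyz: "x \<in> Y" "y \<in> Y" "z \<in> Y" for x y z
  proof (rule ccontr)
    assume "\<not> ?thesis"
    then have uniq: "\<And>t. t \<in> V - U' \<Longrightarrow> \<not> ((\<exists>w\<in>X'. x + t - w \<in> U') \<and>
        (\<exists>w\<in>X'. y - (t + t) - w \<in> U') \<and> (\<exists>w\<in>X'. z + t - w \<in> U'))" by blast
    have V: "x \<in> V" "y \<in> V" "z \<in> V" using xyz YX X'V by auto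
    have g'1: "\<And>m. m \<in> V \<Longrightarrow> g' m \<le> 1" using g'f f(2) by force
    let ?n = "norm (ft g' x) * norm (ft g' y) * norm (ft g' z)"
    have upper: "?n \<le> F * ap3 g' + 3 * ?\<eta> * F * M"
      unfolding M_def by (rule unique_triple_bound[OF odd S(1,2,3) g'0 g'1 S(7) \<eta>0 V uniq])
    have \<nu>M: "0 < \<nu> * M" using \<nu>(1) Mpos by simp
    have "(\<nu> * M) ^ 3 = \<nu> * M * (\<nu> * M) * (\<nu> * M)" by (simp only: power3_eq_cube)
    also have "\<dots> < ?n"
      using xyz \<nu>M unfolding Y_def by (intro mult_strict_mono') auto
    finally have lower: "(\<nu> * M) ^ 3 < ?n" .
    have ZM0: "0 \<le> Z * M" using Z1 M0 by simp
    have "F * ap3 g' \<le> F * (\<theta> * F)"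
      using ap3_mono[of g' f] g'0 g'f f(3) by (intro mult_left_mono) auto
    also have "\<dots> \<le> F * F"
      using \<theta> by (intro mult_left_mono) (auto simp: mult_left_le_one_le)
    also have "\<dots> \<le> (Z * M) * (Z * M)" by (intro mult_mono FZ ZM0) auto
    also have "\<dots> \<le> (Z * M) * (Z * M) * (\<nu> ^ 4 * F)"
      using mult_left_mono[OF \<nu>(3), of "(Z * M) * (Z * M)"] ZM0 by simp
    also have "\<dots> \<le> (Z * M) * (Z * M) * (\<nu> ^ 4 * (Z * M))"
      using ZM0 FZ \<nu>(1) by (intro mult_left_mono) auto
    also have "\<dots> = Z ^ 3 * \<nu> * (\<nu> * M) ^ 3"
      by (simp add: power3_eq_cube power4_eq_xxxx mult_ac)
    finally have first: "F * ap3 g' \<le> Z ^ 3 * \<nu> * (\<nu> * M) ^ 3" .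
    have "?\<eta> * F \<le> \<nu> ^ 4 * (Z * M) * (Z * M)"
      by (rule mult_mono[OF \<eta>Z FZ]) (use \<nu>(1) ZM0 in simp_all)
    then have "?\<eta> * F * M \<le> \<nu> ^ 4 * (Z * M) * (Z * M) * M"
      by (rule mult_right_mono[OF _ M0])
    also have "\<dots> = Z\<^sup>2 * (\<nu> * (\<nu> * M) ^ 3)"
      by (simp add: power3_eq_cube power4_eq_xxxx power2_eq_square mult_ac)
    also have "\<dots> \<le> Z ^ 3 * (\<nu> * (\<nu> * M) ^ 3)"
      using ZZ3(2) \<nu>(1) \<nu>M by (intro mult_right_mono) auto
    finally have second: "?\<eta> * F * M \<le> Z ^ 3 * \<nu> * (\<nu> * M) ^ 3" by (simp only: mult.assoc)
    have "Z ^ 3 * \<nu> * (\<nu> * M) ^ 3 \<le> 1 / 4 * (\<nu> * M) ^ 3"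
      using Z3 \<nu>M by (intro mult_right_mono) auto
    moreover have "3 * ?\<eta> * F * M = 3 * (?\<eta> * F * M)" by (simp only: mult.assoc)
    ultimately show False using upper lower first second by linarith
  qed
  have "card Y ^ 3 \<le> card Y * card X' * (P - 1)\<^sup>2"
    using card_cube_le_of_shifted_triples[OF odd S(1) finX' X'V YX _ triples] S(9) by blast
  then have "card Y * (card Y)\<^sup>2 \<le> card Y * (card X' * (P - 1)\<^sup>2)"
    by (simp only: power3_eq_cube power2_eq_square mult.assoc)
  then have "(card Y)\<^sup>2 \<le> card X' * (P - 1)\<^sup>2" using cardY by simp
  also have "\<dots> \<le> card X * (P - 1)\<^sup>2"
    using card_mono[OF X(1) S(6)] by (rule mult_le_mono1)
  finally have "(card Y)\<^sup>2 \<le> card X * (P - 1)\<^sup>2" .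
  then show ?thesis
    using that[OF S(1,2,3) _ mass'[unfolded M_def] _ specY[unfolded M_def] cardY]
      YX S(6) g'0 g'f by blast
qed

text \<open>
  Round \<open>s\<close> uses popularity \<open>P = k\<^sup>s\<close> and takes \<open>|X| \<le> k\<^bsup>2s+4\<^esup>\<close> to \<open>|Y| \<le> k\<^bsup>2s+2\<^esup>\<close>. For \<open>s = 0\<close>
  no difference outside \<open>U\<close> has any witness, so \<open>Y\<close> would be empty. Round \<open>s\<close> needs at most
  \<open>2k\<^bsup>s+4\<^esup>\<close> slicings; the sum of these bounds over all remaining rounds is at most \<open>4k\<^bsup>s+4\<^esup>\<close> as \<open>k \<ge> 2\<close>.
\<close>

lemma no_moderate_spectral_gap:
  fixes R r k s :: nat and \<theta> \<kappa> :: real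
  assumes "odd CARD('p)" "2 \<le> k" "0 < \<theta>" "\<theta> \<le> 1"
    "\<And>m. m \<in> V \<Longrightarrow> 0 \<le> f m" "\<And>m. m \<in> V \<Longrightarrow> f m \<le> 1" "ap3 f \<le> \<theta> * F"
    "0 < \<kappa>" "4 * (real CARD('p) ^ R / \<theta>) ^ 3 * \<kappa> \<le> 1"
    and "finite X" "X \<subseteq> V" "subspace U" "U \<subseteq> V" "coset_supported U g"
    "\<And>m. m \<in> V \<Longrightarrow> 0 \<le> g m" "\<And>m. m \<in> V \<Longrightarrow> g m \<le> f m"
    "\<theta> * F \<le> real CARD('p) ^ r * (\<Sum>m\<in>V. g m)"
    "spectrum_within g (\<kappa> ^ 4 ^ Suc s * (\<Sum>m\<in>V. g m)) X U"
    "1 \<le> \<kappa> ^ 4 ^ Suc s * F" "card X \<le> k ^ (2 * s + 4)" "r + 4 * k ^ (s + 4) \<le> R"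
  shows False
  using assms(10-)
proof (induction s arbitrary: X U g r)
  case (0 X U g r)
  have \<nu>: "\<kappa> ^ 4 ^ Suc 0 = \<kappa> ^ 4" by simp
  have one: "0 < (1 :: nat)" by simp
  have H: "2 * card X \<le> (2 * k ^ 4) * 1" and R: "r + 2 * k ^ 4 \<le> R"
    using "0.prems"(11,12) by simp_all
  obtain Y :: "'v set" where "0 < card Y" "(card Y)\<^sup>2 \<le> card X * (1 - 1)\<^sup>2"
    by (rule spectrum_shrinks[OF assms(1,3-7) "0.prems"(1-8) "0.prems"(9)[unfolded \<nu>] assms(8,9)
      "0.prems"(10)[unfolded \<nu>] one H R]) blast
  then show False by simp
next
  case (Suc s X U g r)
  define \<nu> where "\<nu> = \<kappa> ^ 4 ^ Suc s"
  have \<nu>4: "\<kappa> ^ 4 ^ Suc (Suc s) = \<nu> ^ 4"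
    by (simp add: \<nu>_def power_mult[symmetric] mult_ac)
  have \<nu>0: "0 < \<nu>" unfolding \<nu>_def using assms(8) by simp
  have Z1: "1 \<le> (real CARD('p) ^ R / \<theta>) ^ 3"
    using assms(3,4) card_field_gt_1
    by (intro one_le_power) (simp add: le_divide_eq one_le_power order_trans)
  have \<kappa>1: "\<kappa> \<le> 1"
    using mult_right_mono[OF Z1, of \<kappa>] assms(8,9) by linarith
  have "\<nu> \<le> \<kappa>"
    unfolding \<nu>_def using power_decreasing[of 1 "4 ^ Suc s" \<kappa>] \<kappa>1 assms(8) by simp
  then have "4 * (real CARD('p) ^ R / \<theta>) ^ 3 * \<nu> \<le> 4 * (real CARD('p) ^ R / \<theta>) ^ 3 * \<kappa>"
    using Z1 by (intro mult_left_mono) linarith+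
  then have Z\<nu>: "4 * (real CARD('p) ^ R / \<theta>) ^ 3 * \<nu> \<le> 1"
    using assms(9) by linarith
  have \<nu>F: "1 \<le> \<nu> ^ 4 * F" using Suc.prems(10) unfolding \<nu>4 .
  have k0: "0 < k" using assms(2) by simp
  have "card X \<le> k ^ (Suc s + 4) * k ^ Suc s"
  proof -
    have "2 * Suc s + 4 = (Suc s + 4) + Suc s" by simp
    then show ?thesis using Suc.prems(11) by (simp only: power_add)
  qed
  then have H: "2 * card X \<le> (2 * k ^ (Suc s + 4)) * k ^ Suc s" by linarith
  have R: "r + 2 * k ^ (Suc s + 4) \<le> R" using Suc.prems(12) by linarith
  have Ppos: "0 < k ^ Suc s" using k0 by simp
  obtain U' Y g' where S: "subspace U'" "U' \<subseteq> V" "coset_supported U' g'"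
    "\<forall>m\<in>V. 0 \<le> g' m \<and> g' m \<le> f m"
    "\<theta> * F \<le> real CARD('p) ^ (r + 2 * k ^ (Suc s + 4)) * (\<Sum>m\<in>V. g' m)"
    "Y \<subseteq> X" "spectrum_within g' (\<nu> * (\<Sum>m\<in>V. g' m)) Y U'"
    "0 < card Y" "(card Y)\<^sup>2 \<le> card X * (k ^ Suc s - 1)\<^sup>2"
    by (rule spectrum_shrinks[OF assms(1,3-7) Suc.prems(1-8) Suc.prems(9)[unfolded \<nu>4] \<nu>0 Z\<nu> \<nu>F
      Ppos H R])
  have "(card Y)\<^sup>2 \<le> k ^ (2 * Suc s + 4) * (k ^ Suc s)\<^sup>2"
    by (rule order_trans[OF S(9)], intro mult_le_mono power_mono Suc.prems(11)) simp_all
  also have "\<dots> = (k ^ (2 * s + 4))\<^sup>2"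
  proof -
    have "2 * Suc s + 4 + Suc s * 2 = (2 * s + 4) * 2" by simp
    then show ?thesis by (simp only: power_mult[symmetric] power_add[symmetric])
  qed
  finally have cardY: "card Y \<le> k ^ (2 * s + 4)"
    by (rule power2_le_imp_le) simp
  have "\<nu> ^ 4 \<le> \<nu>"
    using power_decreasing[of 1 4 \<nu>] \<nu>0 \<open>\<nu> \<le> \<kappa>\<close> \<kappa>1 by simp
  then have "\<nu> ^ 4 * F \<le> \<nu> * F" by (intro mult_right_mono) auto
  then have "1 \<le> \<nu> * F" using \<nu>F by linarith
  have "2 * k ^ (s + 4) \<le> k * k ^ (s + 4)"
    by (rule mult_le_mono1[OF assms(2)])
  moreover have "k * k ^ (s + 4) = k ^ (Suc s + 4)" by (simp only: add_Suc power_Suc)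
  ultimately have R': "r + 2 * k ^ (Suc s + 4) + 4 * k ^ (s + 4) \<le> R"
    using Suc.prems(12) by linarith
  have Y: "finite Y" "Y \<subseteq> V"
    by (rule finite_subset[OF S(6) Suc.prems(1)], rule subset_trans[OF S(6) Suc.prems(2)])
  show False
  proof (rule Suc.IH[OF Y S(1-3) _ _ S(5) S(7)[unfolded \<nu>_def] \<open>1 \<le> \<nu> * F\<close>[unfolded \<nu>_def] cardY R'])
    show "0 \<le> g' m" "g' m \<le> f m" if "m \<in> V" for m using S(4) that by blast+
  qed
qed


section \<open>Dense functions, characteristic two, tiny spectral tails\<close>

text \<open>
  For numbers in \<open>[0, 1]\<close> one has \<open>abc \<ge> a + b + c - 2\<close>.
\<close>

lemma ap3_ge_of_dense:
  assumes "\<And>m. m \<in> V \<Longrightarrow> 0 \<le> f m" "\<And>m. m \<in> V \<Longrightarrow> f m \<le> 1"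
  shows "F * (3 * (\<Sum>m\<in>V. f m) - 2 * F) \<le> ap3 f"
proof -
  have bound: "f m + f (m + d) + f (m + d + d) - 2 \<le> f m * f (m + d) * f (m + d + d)"
    if "m \<in> V" "d \<in> V" for m d
  proof -
    have *: "a + b - 1 \<le> a * b" if "a \<le> 1" "b \<le> 1" for a b :: real
      using mult_nonneg_nonneg[of "1 - a" "1 - b"] that by (simp add: algebra_simps)
    have V: "m \<in> V" "m + d \<in> V" "m + d + d \<in> V" using that by (auto intro!: V_add)
    have "f m * f (m + d) \<le> 1" using V assms by (intro mult_le_one) auto
    then show ?thesis
      using *[of "f m" "f (m + d)"] *[of "f m * f (m + d)" "f (m + d + d)"] V assms(2) by fastforce
  qed
  have "(\<Sum>m\<in>V. f m + f (m + d) + f (m + d + d) - 2) = 3 * (\<Sum>m\<in>V. f m) - 2 * F" if "d \<in> V" for d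
    using sum_translate_right[OF that, of f] sum_translate_right[OF V_add[OF that that], of f]
    by (simp add: sum.distrib sum_subtractf add.assoc)
  then have "F * (3 * (\<Sum>m\<in>V. f m) - 2 * F) = (\<Sum>d\<in>V. \<Sum>m\<in>V. f m + f (m + d) + f (m + d + d) - 2)"
    by simp
  also have "\<dots> \<le> (\<Sum>d\<in>V. \<Sum>m\<in>V. f m * f (m + d) * f (m + d + d))"
    by (intro sum_mono bound)
  also have "\<dots> = ap3 f" unfolding ap3_def by (rule sum.swap)
  finally show ?thesis .
qed

text \<open>
  Progressions degenerate to \<open>m, m + d, m\<close>, so the count is the product of \<open>\<Sum>f\<^sup>2\<close> and \<open>\<Sum>f\<close>.
\<close>

lemma ap3_ge_of_char_two:
  assumes "CARD('p) = 2" "\<And>m. m \<in> V \<Longrightarrow> 0 \<le> f m"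
  shows "(\<Sum>m\<in>V. f m) ^ 3 \<le> F * ap3 f"
proof -
  have "of_nat 2 = (0 :: 'p mod_ring)"
    using of_nat_card_eq_0[where ?'a = 'p] unfolding assms(1) .
  then have two: "(2 :: 'p mod_ring) = 0" by (simp only: of_nat_numeral)
  have dd: "d + d = 0" for d :: 'v
    unfolding double_eq_scale two by (rule scale_zero_left)
  let ?S = "\<Sum>m\<in>V. f m"
  have "ap3 f = (\<Sum>m\<in>V. \<Sum>d\<in>V. (f m)\<^sup>2 * f (m + d))"
    unfolding ap3_def by (simp add: add.assoc dd power2_eq_square mult_ac)
  also have "\<dots> = (\<Sum>m\<in>V. (f m)\<^sup>2 * ?S)"
    by (intro sum.cong refl) (simp only: sum_distrib_left[symmetric] sum_translate)
  also have "\<dots> = (\<Sum>m\<in>V. (f m)\<^sup>2) * ?S" by (simp only: sum_distrib_right)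
  finally have eq: "ap3 f = (\<Sum>m\<in>V. (f m)\<^sup>2) * ?S" .
  have "0 \<le> (\<Sum>m\<in>V. (F * f m - ?S)\<^sup>2)" by (rule sum_nonneg) simp
  also have "\<dots> = (\<Sum>m\<in>V. F\<^sup>2 * (f m)\<^sup>2 - 2 * F * ?S * f m + ?S\<^sup>2)"
    by (intro sum.cong refl) (simp add: power2_eq_square algebra_simps)
  also have "\<dots> = F\<^sup>2 * (\<Sum>m\<in>V. (f m)\<^sup>2) - 2 * F * ?S * ?S + F * ?S\<^sup>2"
    by (simp add: sum.distrib sum_subtractf sum_distrib_left[symmetric])
  also have "\<dots> = F * ((\<Sum>m\<in>V. (f m)\<^sup>2) * F - ?S\<^sup>2)"
    by (simp add: power2_eq_square algebra_simps)
  finally have "?S\<^sup>2 \<le> (\<Sum>m\<in>V. (f m)\<^sup>2) * F"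
    using F_ge_1 by (simp add: zero_le_mult_iff)
  then have "?S\<^sup>2 * ?S \<le> (\<Sum>m\<in>V. (f m)\<^sup>2) * F * ?S"
    using assms(2) by (intro mult_right_mono sum_nonneg)
  then show ?thesis
    by (simp add: eq power3_eq_cube power2_eq_square mult_ac)
qed

text \<open>
  Fourier inversion for the measure counting progressions, at the trivial progression
  \<open>m\<^sub>0, m\<^sub>0, m\<^sub>0\<close>. Two of the three frequencies suffice because the progressions form a space of twice the
  dimension.
\<close>

lemma sum_twisted_ap3:
  assumes "m\<^sub>0 \<in> V"
  shows "(\<Sum>y\<in>V. \<Sum>z\<in>V. echar (- ((y + z) \<cdot> m\<^sub>0)) * twisted_ap3 f 0 y z) = of_real (F\<^sup>2 * f m\<^sub>0 ^ 3)"
proof -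
  let ?f = "\<lambda>m d. of_real (f m * f (m + d) * f (m + d + d)) :: complex"
  have "(\<Sum>y\<in>V. \<Sum>z\<in>V. echar (- ((y + z) \<cdot> m\<^sub>0)) * twisted_ap3 f 0 y z)
      = (\<Sum>y\<in>V. \<Sum>z\<in>V. \<Sum>m\<in>V. \<Sum>d\<in>V.
           ?f m d * (echar (y \<cdot> (m + d - m\<^sub>0)) * echar (z \<cdot> (m + d + d - m\<^sub>0))))"
  proof (intro sum.cong refl)
    fix y z
    have "echar (- ((y + z) \<cdot> m\<^sub>0)) * (?f m d * echar (0 \<cdot> m + y \<cdot> (m + d) + z \<cdot> (m + d + d)))
        = ?f m d * (echar (y \<cdot> (m + d - m\<^sub>0)) * echar (z \<cdot> (m + d + d - m\<^sub>0)))" for m d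
    proof -
      have "- ((y + z) \<cdot> m\<^sub>0) + (0 \<cdot> m + y \<cdot> (m + d) + z \<cdot> (m + d + d))
          = y \<cdot> (m + d - m\<^sub>0) + z \<cdot> (m + d + d - m\<^sub>0)"
        by (simp add: dot_simps algebra_simps)
      from arg_cong[OF this, of echar]
      have e: "echar (- ((y + z) \<cdot> m\<^sub>0)) * echar (0 \<cdot> m + y \<cdot> (m + d) + z \<cdot> (m + d + d))
          = echar (y \<cdot> (m + d - m\<^sub>0)) * echar (z \<cdot> (m + d + d - m\<^sub>0))"
        by (simp only: echar_add)
      show ?thesis unfolding e[symmetric] by (simp only: mult_ac)
    qed
    then show "echar (- ((y + z) \<cdot> m\<^sub>0)) * twisted_ap3 f 0 y z
        = (\<Sum>m\<in>V. \<Sum>d\<in>V. ?f m d * (echar (y \<cdot> (m + d - m\<^sub>0)) * echar (z \<cdot> (m + d + d - m\<^sub>0))))"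
      unfolding twisted_ap3_def sum_distrib_left by (simp only:)
  qed
  also have "\<dots> = (\<Sum>y\<in>V. \<Sum>m\<in>V. \<Sum>d\<in>V. \<Sum>z\<in>V.
           ?f m d * (echar (y \<cdot> (m + d - m\<^sub>0)) * echar (z \<cdot> (m + d + d - m\<^sub>0))))"
    by (rule sum.cong[OF refl], subst sum.swap, rule sum.cong[OF refl], rule sum.swap)
  also have "\<dots> = (\<Sum>m\<in>V. \<Sum>d\<in>V. \<Sum>y\<in>V. \<Sum>z\<in>V.
           ?f m d * (echar (y \<cdot> (m + d - m\<^sub>0)) * echar (z \<cdot> (m + d + d - m\<^sub>0))))"
    by (subst sum.swap, rule sum.cong[OF refl], rule sum.swap)
  also have "\<dots> = (\<Sum>m\<in>V. \<Sum>d\<in>V. ?f m d * ((\<Sum>y\<in>V. echar (y \<cdot> (m + d - m\<^sub>0))) *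
           (\<Sum>z\<in>V. echar (z \<cdot> (m + d + d - m\<^sub>0)))))"
    unfolding sum_product unfolding sum_distrib_left ..
  also have "\<dots> = (\<Sum>m\<in>V. \<Sum>d\<in>V. if d = m\<^sub>0 - m then (if m = m\<^sub>0 then of_real (F\<^sup>2 * f m\<^sub>0 ^ 3) else 0) else 0)"
  proof (intro sum.cong refl)
    fix m d assume V: "m \<in> V" "d \<in> V"
    have V1: "m + d - m\<^sub>0 \<in> V" and V2: "m + d + d - m\<^sub>0 \<in> V"
      using V assms by (auto intro!: V_add V_diff)
    have "m + d - m\<^sub>0 = d - (m\<^sub>0 - m)" by (simp only: diff_conv_add_uminus minus_add_distrib minus_minus add_ac)
    then have d: "m + d - m\<^sub>0 = 0 \<longleftrightarrow> d = m\<^sub>0 - m" by (simp only: right_minus_eq)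
    show "?f m d * ((\<Sum>y\<in>V. echar (y \<cdot> (m + d - m\<^sub>0))) * (\<Sum>z\<in>V. echar (z \<cdot> (m + d + d - m\<^sub>0))))
        = (if d = m\<^sub>0 - m then (if m = m\<^sub>0 then of_real (F\<^sup>2 * f m\<^sub>0 ^ 3) else 0) else 0)"
      unfolding sum_echar[OF V1] sum_echar[OF V2] d
      by (cases "d = m\<^sub>0 - m"; cases "m = m\<^sub>0") (simp_all add: power3_eq_cube power2_eq_square mult_ac)
  qed
  also have "\<dots> = of_real (F\<^sup>2 * f m\<^sub>0 ^ 3)"
    using assms by (simp add: finite_V V_diff)
  finally show ?thesis .
qed

text \<open>
  An uncertainty principle. The value \<open>f(m\<^sub>0)\<^sup>3\<close> at a trivial progression is recovered from the twisted
  counts. Each of these is at most \<open>ap3 f\<close>, and apart from at most \<open>|X|\<^sup>3\<close> of them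
  they are negligible, since in each term of \<open>sum_ft_triple\<close> some factor is at most \<open>\<eta>\<close>.
\<close>

lemma ap3_ge_of_sparse_spectrum:
  assumes f: "\<And>m. m \<in> V \<Longrightarrow> 0 \<le> f m" "\<And>m. m \<in> V \<Longrightarrow> f m \<le> 1"
    and X: "finite X" "\<And>a. a \<in> V \<Longrightarrow> a \<notin> X \<Longrightarrow> norm (ft f a) \<le> \<eta>" "0 \<le> \<eta>"
    and m0: "m\<^sub>0 \<in> V"
  shows "F ^ 3 * f m\<^sub>0 ^ 3 \<le> real (card X) ^ 3 * (F * ap3 f) + \<eta> * F ^ 5"
proof -
  define T where "T y z = of_real F * twisted_ap3 f 0 y z" for y z
  define Q where "Q = (\<lambda>(a, b, c). (b + (a + a), c - a)) ` (X \<times> X \<times> X)"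
  have finQ: "finite Q" unfolding Q_def using X(1) by simp
  have "card Q \<le> card (X \<times> X \<times> X)" unfolding Q_def using X(1) by (intro card_image_le) simp
  also have "\<dots> = card X ^ 3" by (simp add: card_cartesian_product power3_eq_cube)
  finally have cardQ: "real (card Q) \<le> real (card X) ^ 3" by (metis of_nat_le_iff of_nat_power)
  have ap0: "0 \<le> ap3 f" by (rule order_trans[OF norm_ge_zero norm_twisted_ap3_le[of f 0 0 0]]) (rule f(1))
  have on_Q: "norm (T y z) \<le> F * ap3 f" for y z
    unfolding T_def using norm_twisted_ap3_le[of f 0 y z] f(1) by (simp add: norm_mult mult_left_mono)
  have ftF: "norm (ft f a) \<le> F" for a
  proof -
    have "norm (ft f a) \<le> (\<Sum>m\<in>V. f m)" by (rule norm_ft_le[OF f(1)])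
    also have "\<dots> \<le> (\<Sum>m\<in>V. 1)" by (intro sum_mono f(2))
    finally show ?thesis by simp
  qed
  have off_Q: "norm (T y z) \<le> F * (\<eta> * F\<^sup>2)" if yz: "y \<in> V" "z \<in> V" "(y, z) \<notin> Q" for y z
  proof -
    have "norm (ft f (0 + t) * ft f (y - (t + t)) * ft f (z + t)) \<le> \<eta> * F\<^sup>2" if "t \<in> V" for t
    proof -
      let ?a = "norm (ft f (0 + t))" and ?b = "norm (ft f (y - (t + t)))" and ?c = "norm (ft f (z + t))"
      have V: "0 + t \<in> V" "y - (t + t) \<in> V" "z + t \<in> V"
        using that yz by (auto intro!: V_add V_diff)
      have "\<not> (0 + t \<in> X \<and> y - (t + t) \<in> X \<and> z + t \<in> X)"
      proof
        assume "0 + t \<in> X \<and> y - (t + t) \<in> X \<and> z + t \<in> X"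
        then have "(t, y - (t + t), z + t) \<in> X \<times> X \<times> X" by simp
        then have "(\<lambda>(a, b, c). (b + (a + a), c - a)) (t, y - (t + t), z + t) \<in> Q"
          unfolding Q_def by (rule imageI)
        then show False using yz(3) by simp
      qed
      then have "?a \<le> \<eta> \<or> ?b \<le> \<eta> \<or> ?c \<le> \<eta>" using X(2) V by blast
      then have "?a * ?b * ?c \<le> \<eta> * (F * F)"
      proof (elim disjE)
        assume "?a \<le> \<eta>"
        then have "?a * (?b * ?c) \<le> \<eta> * (F * F)" by (intro mult_mono ftF X(3)) auto
        then show ?thesis by (simp only: mult.assoc)
      next
        assume "?b \<le> \<eta>"
        then have "?b * (?a * ?c) \<le> \<eta> * (F * F)" by (intro mult_mono ftF X(3)) auto
        then show ?thesis by (simp only: mult_ac)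
      next
        assume "?c \<le> \<eta>"
        then have "?c * (?a * ?b) \<le> \<eta> * (F * F)" by (intro mult_mono ftF X(3)) auto
        then show ?thesis by (simp only: mult_ac)
      qed
      then show ?thesis by (simp only: norm_mult power2_eq_square)
    qed
    then have "norm (\<Sum>t\<in>V. ft f (0 + t) * ft f (y - (t + t)) * ft f (z + t)) \<le> (\<Sum>t\<in>V. \<eta> * F\<^sup>2)"
      by (rule sum_norm_le)
    then show ?thesis unfolding sum_ft_triple T_def by simp
  qed
  have "F ^ 3 * f m\<^sub>0 ^ 3 = norm (of_real F * (of_real (F\<^sup>2 * f m\<^sub>0 ^ 3) :: complex))"
    unfolding of_real_mult[symmetric] norm_of_real
    using f(1)[OF m0] by (simp add: power3_eq_cube power2_eq_square mult_ac)
  also have "of_real F * (of_real (F\<^sup>2 * f m\<^sub>0 ^ 3) :: complex)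
      = (\<Sum>y\<in>V. \<Sum>z\<in>V. echar (- ((y + z) \<cdot> m\<^sub>0)) * T y z)"
    unfolding sum_twisted_ap3[OF m0, symmetric] sum_distrib_left T_def
    by (intro sum.cong refl) (simp only: mult_ac)
  also have "norm \<dots> \<le> (\<Sum>y\<in>V. \<Sum>z\<in>V. norm (T y z))"
    by (intro sum_norm_le) (simp add: norm_mult)
  also have "\<dots> = (\<Sum>yz\<in>V\<times>V. norm (T (fst yz) (snd yz)))"
    by (simp add: sum.cartesian_product case_prod_unfold)
  also have "\<dots> \<le> (\<Sum>yz\<in>V\<times>V. (if yz \<in> Q then F * ap3 f else 0) + F * (\<eta> * F\<^sup>2))"
  proof (rule sum_mono)
    fix yz assume "yz \<in> V \<times> V"
    then have V: "fst yz \<in> V" "snd yz \<in> V" by auto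
    have "0 \<le> F * (\<eta> * F\<^sup>2)" using X(3) by simp
    then show "norm (T (fst yz) (snd yz)) \<le> (if yz \<in> Q then F * ap3 f else 0) + F * (\<eta> * F\<^sup>2)"
      using on_Q[of "fst yz" "snd yz"] off_Q[OF V] by simp
  qed
  also have "\<dots> = real (card (V \<times> V \<inter> Q)) * (F * ap3 f) + F\<^sup>2 * (F * (\<eta> * F\<^sup>2))"
    using finite_V by (simp add: sum.distrib sum.If_cases card_cartesian_product power2_eq_square)
  also have "\<dots> \<le> real (card X) ^ 3 * (F * ap3 f) + \<eta> * F ^ 5"
  proof (rule add_mono)
    have "real (card (V \<times> V \<inter> Q)) \<le> real (card Q)"
      using card_mono[OF finQ, of "V \<times> V \<inter> Q"] by simp
    then show "real (card (V \<times> V \<inter> Q)) * (F * ap3 f) \<le> real (card X) ^ 3 * (F * ap3 f)"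
      using cardQ ap0 by (intro mult_right_mono) auto
    show "F\<^sup>2 * (F * (\<eta> * F\<^sup>2)) \<le> \<eta> * F ^ 5"
      by (simp add: eval_nat_numeral mult_ac)
  qed
  finally show ?thesis .
qed

end

section \<open>Choice of parameters\<close>

text \<open>
  The choice of the base \<open>k\<close>, the index \<open>s\<close> of the first round, the bound \<open>R\<close> for the number of slicings and
  the final threshold \<open>\<kappa>\<close>. With \<open>s\<close> minimal, \<open>k\<^sup>s \<le> \<surd>j\<close>, so \<open>ln (1/\<kappa>)\<close> is
  \<open>O(\<surd>j ln (1/\<theta>))\<close>; here \<open>\<theta> \<le> 3/4\<close> keeps \<open>ln (1/\<theta>)\<close> away from \<open>0\<close>. The initial threshold
  \<open>\<kappa>\<^bsup>4^(s+1)\<^esup>\<close> then has logarithm \<open>O(j\<^bsup>1/2+\<delta>/4\<^esup> ln (1/\<theta>))\<close> in size. This is smaller than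
  \<open>j\<^bsup>1/2+\<delta>\<^esup> ln (1/\<theta>)\<close> by a factor that grows with \<open>j\<close>, which pays both for the comparison with the
  hypothesis and for \<open>\<kappa>\<^bsup>4^(s+1)\<^esup> F \<ge> 1\<close>.
\<close>

lemma gap_parameters:
  fixes \<delta> p :: real
  assumes \<delta>: "\<delta> > 0" and p: "p > 1"
  obtains k J\<^sub>0 :: nat where "2 \<le> k"
    "\<And>j \<theta> F. J\<^sub>0 < j \<Longrightarrow> 0 < \<theta> \<Longrightarrow> \<theta> \<le> 3 / 4 \<Longrightarrow> 1 \<le> F \<Longrightarrow>
       F powr (-4) < \<theta> powr (real j powr (1 / 2 + \<delta>)) \<Longrightarrow>
       \<exists>s R \<kappa>. j \<le> k ^ (2 * s + 4) \<and> 4 * k ^ (s + 4) \<le> R \<and> 0 < \<kappa> \<and>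
         4 * (p ^ R / \<theta>) ^ 3 * \<kappa> \<le> 1 \<and> 1 \<le> \<kappa> ^ 4 ^ Suc s * F \<and>
         \<theta> powr (real j powr (1 / 2 + \<delta>)) \<le> \<kappa> ^ 4 ^ Suc s * \<theta>"
proof -
  \<comment> \<open>large enough that \<open>4\<^sup>s \<le> (k\<^sup>s)\<^bsup>\<delta>/2\<^esup>\<close>\<close>
  define k :: nat where "k = nat \<lceil>4 powr (2 / \<delta>)\<rceil> + 2"
  \<comment> \<open>\<open>ln (1/\<kappa>) \<le> C \<surd>j ln (1/\<theta>)\<close> below\<close>
  define C where "C = 15 + 48 * real k ^ 4 * ln p"
  \<comment> \<open>so that \<open>j\<^bsup>3\<delta>/4\<^esup> \<ge> 16 C\<close> for \<open>j > J\<^sub>0\<close>\<close>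
  define J\<^sub>0 where "J\<^sub>0 = nat \<lceil>(16 * C) powr (4 / (3 * \<delta>))\<rceil>"
  have k2: "2 \<le> k" by (simp add: k_def)
  have "4 powr (2 / \<delta>) \<le> real k" unfolding k_def by linarith
  then have "(4 powr (2 / \<delta>)) powr (\<delta> / 2) \<le> real k powr (\<delta> / 2)"
    using \<delta> by (intro powr_mono2) auto
  then have k\<delta>: "4 \<le> real k powr (\<delta> / 2)"
    using \<delta> by (simp add: powr_powr)
  have lnp: "0 < ln p" using p by simp
  then have C15: "15 \<le> C" unfolding C_def by simp
  have "\<exists>s R \<kappa>. j \<le> k ^ (2 * s + 4) \<and> 4 * k ^ (s + 4) \<le> R \<and> 0 < \<kappa> \<and>
         4 * (p ^ R / \<theta>) ^ 3 * \<kappa> \<le> 1 \<and> 1 \<le> \<kappa> ^ 4 ^ Suc s * F \<and>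
         \<theta> powr (real j powr (1 / 2 + \<delta>)) \<le> \<kappa> ^ 4 ^ Suc s * \<theta>"
    if j: "J\<^sub>0 < j" and \<theta>: "0 < \<theta>" "\<theta> \<le> 3 / 4" and F: "1 \<le> F"
      and FL: "F powr (-4) < \<theta> powr (real j powr (1 / 2 + \<delta>))" for j :: nat and \<theta> F :: real
  proof -
    define L where "L = real j powr (1 / 2 + \<delta>)"
    define l where "l = - ln \<theta>"
    define q where "q = real j powr (1 / 2)"
    define e where "e = real j powr (\<delta> / 4)"
    define b where "b = real j powr (3 * \<delta> / 4)"
    have j1: "1 \<le> real j" using j by simp
    have l14: "1 / 4 \<le> l"
      using ln_le_minus_one[OF \<theta>(1)] \<theta>(2) unfolding l_def by linarith
    have q1: "1 \<le> q" unfolding q_def using j1 by (intro ge_one_powr_ge_zero) auto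
    have e1: "1 \<le> e" unfolding e_def using j1 \<delta> by (intro ge_one_powr_ge_zero) auto
    have Lqeb: "L = q * e * b"
      unfolding L_def q_def e_def b_def powr_add[symmetric]
      by (rule arg_cong[where f = "\<lambda>t. real j powr t"]) (simp add: field_simps)
    have "(16 * C) powr (4 / (3 * \<delta>)) \<le> real j"
      using j unfolding J\<^sub>0_def by linarith
    then have "((16 * C) powr (4 / (3 * \<delta>))) powr (3 * \<delta> / 4) \<le> b"
      unfolding b_def using \<delta> by (intro powr_mono2) auto
    then have bC: "16 * C \<le> b"
      using \<delta> C15 by (simp add: powr_powr)
    \<comment> \<open>minimality gives \<open>k\<^sup>s \<le> \<surd>j\<close>\<close>
    define s where "s = (LEAST s. j \<le> k ^ (2 * s + 4))"
    have "\<exists>s. j \<le> k ^ (2 * s + 4)"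
    proof
      have "j \<le> 2 ^ j" using less_exp[of j] by (rule less_imp_le)
      also have "\<dots> \<le> k ^ j" by (rule power_mono[OF k2]) simp
      also have "\<dots> \<le> k ^ (2 * j + 4)" using k2 by (intro power_increasing) auto
      finally show "j \<le> k ^ (2 * j + 4)" .
    qed
    then have js: "j \<le> k ^ (2 * s + 4)" unfolding s_def by (rule LeastI_ex)
    have "k ^ (2 * s) \<le> j"
    proof (cases s)
      case 0
      then show ?thesis using j by simp
    next
      case (Suc s')
      have "\<not> j \<le> k ^ (2 * s' + 4)"
        using not_less_Least[of s' "\<lambda>s. j \<le> k ^ (2 * s + 4)"] Suc unfolding s_def by simp
      then have "k ^ (2 * s' + 4) \<le> j" by simp
      moreover have "k ^ (2 * s) \<le> k ^ (2 * s' + 4)"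
        using k2 Suc by (intro power_increasing) auto
      ultimately show ?thesis by (rule order_trans[rotated])
    qed
    then have "real (k ^ (2 * s)) \<le> real j" by (rule of_nat_mono)
    then have "(real k ^ s)\<^sup>2 \<le> real j"
      by (simp only: of_nat_power power_even_eq)
    then have "real k ^ s \<le> sqrt (real j)" by (rule real_le_rsqrt)
    then have kq: "real k ^ s \<le> q" unfolding q_def using j1 by (simp only: powr_half_sqrt)
    have "4 ^ s \<le> (real k powr (\<delta> / 2)) ^ s" by (rule power_mono[OF k\<delta>]) simp
    also have "\<dots> = (real k ^ s) powr (\<delta> / 2)"
      using k2 by (simp add: powr_realpow[symmetric] powr_powr mult.commute)
    also have "\<dots> \<le> q powr (\<delta> / 2)" using kq \<delta> by (intro powr_mono2) auto
    also have "\<dots> = e" unfolding q_def e_def by (simp add: powr_powr)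
    finally have se: "4 ^ s \<le> e" .
    define R where "R = 4 * k ^ (s + 4)"
    \<comment> \<open>equality in \<open>4 (p\<^sup>R / \<theta>)\<^sup>3 \<kappa> \<le> 1\<close>\<close>
    define \<kappa> where "\<kappa> = (\<theta> / p ^ R) ^ 3 / 4"
    have \<kappa>0: "0 < \<kappa>" unfolding \<kappa>_def using \<theta>(1) p by simp
    have pR: "0 < p ^ R" using p by simp
    have "4 * (p ^ R / \<theta>) ^ 3 * \<kappa> = 1"
      unfolding \<kappa>_def using \<theta>(1) pR p by (simp add: power_divide)
    then have Z: "4 * (p ^ R / \<theta>) ^ 3 * \<kappa> \<le> 1" by simp
    have ln\<kappa>: "- ln \<kappa> = 3 * l + 3 * (real R * ln p) + ln 4"
    proof -
      have "ln \<kappa> = ln ((\<theta> / p ^ R) ^ 3) - ln 4"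
        unfolding \<kappa>_def using \<theta>(1) p by (simp add: ln_div)
      also have "ln ((\<theta> / p ^ R) ^ 3) = 3 * ln (\<theta> / p ^ R)"
        using \<theta>(1) pR ln_realpow[of "\<theta> / p ^ R" 3] by simp
      also have "ln (\<theta> / p ^ R) = ln \<theta> - ln (p ^ R)"
        using \<theta>(1) p by (simp add: ln_div)
      also have "ln (p ^ R) = real R * ln p" by (rule ln_realpow)
      finally show ?thesis unfolding l_def by (simp add: algebra_simps)
    qed
    have "real R * ln p = (4 * real k ^ 4 * ln p) * real k ^ s"
      unfolding R_def by (simp add: power_add)
    also have "\<dots> \<le> (4 * real k ^ 4 * ln p) * q"
      using lnp by (intro mult_left_mono kq) auto
    also have "\<dots> \<le> (4 * real k ^ 4 * ln p) * q * (4 * l)"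
    proof -
      have "0 \<le> (4 * real k ^ 4 * ln p) * q" using lnp q1 by simp
      from mult_left_mono[OF _ this, of 1 "4 * l"] show ?thesis using l14 by simp
    qed
    finally have Rp: "real R * ln p \<le> 16 * real k ^ 4 * ln p * q * l" by (simp add: mult_ac)
    have ln4: "ln 4 \<le> 12 * l" using ln_le_minus_one[of 4] l14 by simp
    have "l \<le> q * l" using q1 l14 by simp
    then have "- ln \<kappa> \<le> 15 * (q * l) + 3 * (16 * real k ^ 4 * ln p * q * l)"
      unfolding ln\<kappa> using Rp ln4 by linarith
    also have "\<dots> = C * (q * l)" unfolding C_def by (simp add: algebra_simps)
    finally have ln\<kappa>C: "- ln \<kappa> \<le> C * (q * l)" .
    have ql: "0 \<le> C * (q * l)" using C15 q1 l14 by simp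
    define B where "B = 4 ^ Suc s * (- ln \<kappa>)"
    have "B \<le> 4 ^ Suc s * (C * (q * l))"
      unfolding B_def by (intro mult_left_mono ln\<kappa>C) simp
    also have "\<dots> \<le> 4 * e * (C * (q * l))"
      using se by (intro mult_right_mono ql) simp
    finally have "4 * B \<le> 16 * C * (q * e * l)" by (simp add: mult_ac)
    also have "\<dots> \<le> b * (q * e * l)"
      using bC q1 e1 l14 by (intro mult_right_mono) auto
    also have "\<dots> = L * l" unfolding Lqeb by (simp add: mult_ac)
    finally have BL: "4 * B \<le> L * l" .
    have "1 * b \<le> q * e * b"
      using q1 e1 bC C15 mult_mono[OF q1 e1] by (intro mult_right_mono) auto
    then have "2 \<le> L" unfolding Lqeb using bC C15 by linarith
    then have L2: "2 * l \<le> L * l" using l14 by (intro mult_right_mono) auto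
    have "ln (F powr (-4)) < ln (\<theta> powr L)"
      using FL F \<theta>(1) unfolding L_def[symmetric] by (subst ln_less_cancel_iff) auto
    then have lnF: "L * l < 4 * ln F" unfolding l_def using F \<theta>(1) by simp
    have \<kappa>B: "\<kappa> ^ 4 ^ Suc s = exp (- B)"
    proof -
      have "\<kappa> ^ 4 ^ Suc s = exp (real (4 ^ Suc s) * ln \<kappa>)"
        using \<kappa>0 by (simp only: exp_of_nat_mult exp_ln)
      also have "real (4 ^ Suc s) * ln \<kappa> = - B" unfolding B_def by simp
      finally show ?thesis .
    qed
    have "exp 0 \<le> exp (- B + ln F)" using BL lnF by (intro exp_le_cancel_iff[THEN iffD2]) linarith
    then have "1 \<le> \<kappa> ^ 4 ^ Suc s * F"
      unfolding \<kappa>B exp_add using F by simp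
    moreover have "\<theta> powr L \<le> \<kappa> ^ 4 ^ Suc s * \<theta>"
    proof -
      have "0 < L * l" using L2 l14 by linarith
      have "\<theta> powr L = exp (- (L * l))" using \<theta>(1) by (simp add: powr_def l_def)
      also have "\<dots> \<le> exp (- B + - l)"
        using BL L2 \<open>0 < L * l\<close> by (intro exp_le_cancel_iff[THEN iffD2]) linarith
      also have "\<dots> = \<kappa> ^ 4 ^ Suc s * \<theta>" unfolding \<kappa>B exp_add l_def using \<theta>(1) by simp
      finally show ?thesis .
    qed
    ultimately show ?thesis
      using js Z \<kappa>0 unfolding L_def by (intro exI[of _ s] exI[of _ R] exI[of _ \<kappa>]) (simp add: R_def)
  qed
  then show ?thesis using that k2 by blast
qed

context dot_space
begin

text \<open>
  The exponent \<open>L\<close> stands for \<open>j\<^bsup>1/2+\<delta>\<^esup>\<close>. If the threshold \<open>\<theta>\<^sup>L\<close> is below \<open>F\<^bsup>-4\<^esup>\<close>, the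
  uncertainty principle yields \<open>\<theta>\<^sup>3 F\<^sup>3 \<le> j\<^sup>3 F \<cdot> ap3 f + F\<^sup>2\<close>, and the bounds \<open>\<theta> > F\<^bsup>-1/9\<^esup>\<close> and
  \<open>j < F\<^bsup>1/8\<^esup>\<close> combine to rule out \<open>ap3 f \<le> \<theta> F\<close>. Above \<open>F\<^bsup>-4\<^esup>\<close> the iteration starts with
  \<open>U = {0}\<close> and the function itself.
\<close>

lemma ap3_gt_of_spectral_gap:
  fixes j k :: nat and L \<theta> \<eta> :: real
  assumes f: "\<And>m. m \<in> V \<Longrightarrow> 0 \<le> f m" "\<And>m. m \<in> V \<Longrightarrow> f m \<le> 1"
    and mean: "(\<Sum>m\<in>V. f m) = \<theta> * F"
    and F8: "8 \<le> F" and \<theta>: "F powr (- 1 / 9) < \<theta>" "\<theta> \<le> 1"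
    and X: "finite X" "X \<subseteq> V" "card X \<le> j" and j: "real j < F powr (1 / 8)"
    and \<eta>: "\<And>a. a \<in> V \<Longrightarrow> a \<notin> X \<Longrightarrow> norm (ft f a) \<le> \<eta>" "0 \<le> \<eta>" "\<eta> < \<theta> powr L * F"
    and k2: "2 \<le> k"
    and params: "\<theta> \<le> 3 / 4 \<Longrightarrow> F powr (-4) < \<theta> powr L \<Longrightarrow>
       \<exists>s R \<kappa>. j \<le> k ^ (2 * s + 4) \<and> 4 * k ^ (s + 4) \<le> R \<and> 0 < \<kappa> \<and>
         4 * (real CARD('p) ^ R / \<theta>) ^ 3 * \<kappa> \<le> 1 \<and> 1 \<le> \<kappa> ^ 4 ^ Suc s * F \<and>
         \<theta> powr L \<le> \<kappa> ^ 4 ^ Suc s * \<theta>"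
  shows "\<theta> * F < ap3 f"
proof -
  have F0: "0 < F" using F8 by linarith
  have F1: "1 < F" using F8 by linarith
  have "0 \<le> F powr (- 1 / 9)" by simp
  then have \<theta>0: "0 < \<theta>" using \<theta>(1) by linarith
  consider (two) "CARD('p) = 2" | (dense) "\<theta> > 3 / 4"
    | (tiny) "\<theta> powr L \<le> F powr (-4)"
    | (moderate) "CARD('p) \<noteq> 2" "\<theta> \<le> 3 / 4" "F powr (-4) < \<theta> powr L"
    by linarith
  then show ?thesis
  proof cases
    case two
    have "F powr (- 1) \<le> F powr (- 2 / 9)" using F1 by (intro powr_mono) auto
    also have "\<dots> = (F powr (- 1 / 9)) * (F powr (- 1 / 9))"
      by (simp add: powr_add[symmetric])
    also have "\<dots> < \<theta> * \<theta>" using \<theta>(1) \<theta>0 by (intro mult_strict_mono) auto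
    finally have "1 < \<theta> * \<theta> * F" using F0 by (simp add: powr_minus field_simps)
    then have "(\<theta> * F * F) * 1 < (\<theta> * F * F) * (\<theta> * \<theta> * F)"
      using \<theta>0 F0 by (intro mult_strict_left_mono) auto
    also have "\<dots> = (\<Sum>m\<in>V. f m) ^ 3" unfolding mean by (simp add: power3_eq_cube mult_ac)
    also have "\<dots> \<le> F * ap3 f" by (rule ap3_ge_of_char_two[OF two f(1)])
    finally have "F * (\<theta> * F) < F * ap3 f" by (simp add: mult_ac)
    then show ?thesis using F0 by simp
  next
    case dense
    have "\<theta> < 8 * (3 * \<theta> - 2)" using dense by simp
    also have "\<dots> \<le> F * (3 * \<theta> - 2)" using F8 dense by (intro mult_right_mono) auto
    finally have "F * \<theta> < F * (F * (3 * \<theta> - 2))" using F0 by simp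
    also have "\<dots> = F * (3 * (\<Sum>m\<in>V. f m) - 2 * F)" unfolding mean by (simp add: algebra_simps)
    also have "\<dots> \<le> ap3 f" by (rule ap3_ge_of_dense[OF f])
    finally show ?thesis by (simp add: mult.commute)
  next
    case tiny
    show ?thesis
    proof (rule ccontr)
      assume "\<not> ?thesis"
      then have ap: "ap3 f \<le> \<theta> * F" by simp
      \<comment> \<open>a point where f is at least its mean\<close>
      have "\<exists>m\<in>V. \<theta> \<le> f m"
      proof (rule ccontr)
        assume "\<not> ?thesis"
        then have "(\<Sum>m\<in>V. f m) < (\<Sum>m\<in>V. \<theta>)"
          using V_0 finite_V by (intro sum_strict_mono) auto
        then show False unfolding mean by simp
      qed
      then obtain m\<^sub>0 where m0: "m\<^sub>0 \<in> V" "\<theta> \<le> f m\<^sub>0" by blast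
      have F4: "F powr (-4) = 1 / F ^ 4" using F0 by (simp add: powr_minus powr_numeral divide_inverse)
      have "\<eta> \<le> F powr (-4) * F"
        using \<eta>(3) mult_right_mono[OF tiny, of F] F0 by linarith
      also have "\<dots> = 1 / F ^ 3" unfolding F4 using F0 by (simp add: eval_nat_numeral)
      finally have \<eta>F: "\<eta> * F ^ 5 \<le> F\<^sup>2"
        using F0 by (simp add: field_simps eval_nat_numeral)
      have "real (card X) ^ 3 \<le> (F powr (1 / 8)) ^ 3"
        using X(3) j by (intro power_mono) linarith+
      also have "\<dots> = F powr (3 / 8)" using F0 by (simp add: powr_realpow[symmetric] powr_powr)
      finally have X3: "real (card X) ^ 3 \<le> F powr (3 / 8)" .
      have "(F * \<theta>) ^ 3 = F ^ 3 * \<theta> ^ 3" by (rule power_mult_distrib)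
      also have "\<dots> \<le> F ^ 3 * f m\<^sub>0 ^ 3" using m0(2) \<theta>0 by (intro mult_left_mono power_mono) auto
      also have "\<dots> \<le> real (card X) ^ 3 * (F * ap3 f) + \<eta> * F ^ 5"
        by (rule ap3_ge_of_sparse_spectrum[OF f X(1) \<eta>(1,2) m0(1)])
      also have "\<dots> \<le> F powr (3 / 8) * (F * (\<theta> * F)) + F\<^sup>2"
        by (intro add_mono mult_mono X3 \<eta>F mult_left_mono ap) (use F0 \<theta>0 f(1) in
          \<open>auto simp: ap3_def intro!: sum_nonneg mult_nonneg_nonneg V_add\<close>)
      finally have "F\<^sup>2 * (F * \<theta> ^ 3) \<le> F\<^sup>2 * (F powr (3 / 8) * \<theta> + 1)"
        by (simp add: power2_eq_square power3_eq_cube algebra_simps)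
      then have main: "F * \<theta> ^ 3 \<le> F powr (3 / 8) * \<theta> + 1" using F0 by simp
      have "1 < \<theta> * F powr (1 / 9)"
        using mult_strict_right_mono[OF \<theta>(1), of "F powr (1 / 9)"] F0
        by (simp add: powr_add[symmetric])
      also have "\<dots> \<le> \<theta> * F powr (3 / 8)"
        using F1 \<theta>0 by (intro mult_left_mono powr_mono) auto
      finally have upper: "F * \<theta> ^ 3 < 2 * (\<theta> * F powr (3 / 8))"
        using main by (simp add: mult_ac)
      \<comment> \<open>the exponents: 1 - 2/9 - 3/8 = 29/72, which exceeds 1/3, and F is at least 8\<close>
      have "(2 :: real) = 8 powr (1 / 3)"
        using powr_powr[of 2 3 "1 / 3"] by simp
      also have "\<dots> \<le> F powr (1 / 3)" using F8 by (intro powr_mono2) auto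
      also have "\<dots> \<le> F powr (29 / 72)" using F1 by (intro powr_mono) auto
      finally have "2 * F powr (3 / 8) \<le> F powr (29 / 72) * F powr (3 / 8)"
        by (intro mult_right_mono) auto
      also have "\<dots> = F * (F powr (- 1 / 9) * F powr (- 1 / 9))"
        using F0 by (simp add: powr_add[symmetric] powr_mult_base)
      also have "\<dots> \<le> F * (\<theta> * \<theta>)"
        using \<theta>(1) \<theta>0 F0 by (intro mult_left_mono mult_mono) auto
      finally have "\<theta> * (2 * F powr (3 / 8)) \<le> \<theta> * (F * (\<theta> * \<theta>))"
        using \<theta>0 by (intro mult_left_mono) auto
      then show False using upper by (simp add: power3_eq_cube mult_ac)
    qed
  next
    case moderate
    show ?thesis
    proof (rule ccontr)
      assume "\<not> ?thesis"
      then have ap: "ap3 f \<le> \<theta> * F" by simp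
      have odd: "odd CARD('p)"
        using prime_odd_nat[OF prime_card[where ?'a = 'p]] moderate(1)
          prime_ge_2_nat[OF prime_card[where ?'a = 'p]] by linarith
      obtain s R \<kappa> where P: "j \<le> k ^ (2 * s + 4)" "4 * k ^ (s + 4) \<le> R" "0 < \<kappa>"
        "4 * (real CARD('p) ^ R / \<theta>) ^ 3 * \<kappa> \<le> 1" "1 \<le> \<kappa> ^ 4 ^ Suc s * F"
        "\<theta> powr L \<le> \<kappa> ^ 4 ^ Suc s * \<theta>"
        using params[OF moderate(2,3)] by blast
      have "\<eta> \<le> \<kappa> ^ 4 ^ Suc s * \<theta> * F"
        using \<eta>(3) mult_right_mono[OF P(6), of F] F0 by linarith
      then have "\<eta> \<le> \<kappa> ^ 4 ^ Suc s * (\<Sum>m\<in>V. f m)" unfolding mean by (simp only: mult.assoc)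
      then have spec: "spectrum_within f (\<kappa> ^ 4 ^ Suc s * (\<Sum>m\<in>V. f m)) X {0}"
        using \<eta>(1) unfolding spectrum_within_def by force
      have supp: "coset_supported {0} f" unfolding coset_supported_def by simp
      show False
        by (rule no_moderate_spectral_gap[OF odd k2 \<theta>0 \<theta>(2) f ap P(3,4) X(1,2) subspace_single_0 _ supp f(1)
          order_refl _ spec P(5), where r = 0])
          (use V_0 X(3) P(1,2) mean in auto)
    qed
  qed
qed

end

section \<open>Coordinates\<close>

text \<open>
  The dimension of a vector of type \<open>'a vec\<close> is part of its value, so that type is not a group. The
  functions on \<open>nat\<close> that vanish from \<open>n\<close> on form an isomorphic copy of \<open>carrier_vec n\<close> inside a type that is one.
\<close>

definition coord_space :: "nat \<Rightarrow> (nat \<Rightarrow> 'a::zero) set" where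
  "coord_space n = {x. \<forall>i\<ge>n. x i = 0}"

definition coord_dot :: "nat \<Rightarrow> (nat \<Rightarrow> 'a::comm_ring_1) \<Rightarrow> (nat \<Rightarrow> 'a) \<Rightarrow> 'a" where
  "coord_dot n x y = (\<Sum>i<n. x i * y i)"

definition coords :: "'a::zero vec \<Rightarrow> nat \<Rightarrow> 'a" where
  "coords v = (\<lambda>i. if i < dim_vec v then v $ i else 0)"

lemma finite_carrier_vec_of_finite: "finite (carrier_vec n :: 'a::finite vec set)"
proof (rule finite_subset)
  show "carrier_vec n \<subseteq> vec_of_list ` {xs :: 'a list. set xs \<subseteq> UNIV \<and> length xs = n}"
  proof
    fix v :: "'a vec" assume "v \<in> carrier_vec n"
    then show "v \<in> vec_of_list ` {xs. set xs \<subseteq> UNIV \<and> length xs = n}"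
      by (intro image_eqI[of _ _ "list_of_vec v"]) (simp_all add: vec_list)
  qed
qed (intro finite_imageI finite_lists_length_eq finite)

lemma bij_betw_vec: "bij_betw (vec n) (coord_space n) (carrier_vec n)"
  by (rule bij_betw_byWitness[where f' = coords])
    (auto simp: coord_space_def coords_def fun_eq_iff not_less intro!: eq_vecI)

lemma coord_dot_eq: "coord_dot n x y = scalar_prod (vec n x) (vec n y)"
  by (simp add: coord_dot_def scalar_prod_def lessThan_atLeast0)

lemma dot_space_coords:
  "dot_space (\<lambda>(k :: 'p::prime_card mod_ring) x i. k * x i) (coord_space n) (coord_dot n)"
proof -
  interpret vs: vector_space "\<lambda>(k :: 'p mod_ring) (x :: nat \<Rightarrow> 'p mod_ring) i. k * x i"
    by unfold_locales (auto simp: fun_eq_iff algebra_simps)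
  show ?thesis
  proof
    show "vs.subspace (coord_space n)"
      by (auto simp: vs.subspace_def coord_space_def)
    show "finite (coord_space n :: (nat \<Rightarrow> 'p mod_ring) set)"
      using bij_betw_finite[OF bij_betw_vec] finite_carrier_vec_of_finite by blast
    fix m :: "nat \<Rightarrow> 'p mod_ring" assume m: "m \<in> coord_space n" "m \<noteq> 0"
    then obtain i where i: "m i \<noteq> 0" by (auto simp: fun_eq_iff)
    then have "i < n" using m(1) by (auto simp: coord_space_def not_less[symmetric])
    let ?x = "\<lambda>l. if l = i then 1 else (0 :: 'p mod_ring)"
    have "coord_dot n ?x m = m i"
      using \<open>i < n\<close> by (simp add: coord_dot_def if_distrib[of "\<lambda>c. c * _"] cong: if_cong)
    moreover have "?x \<in> coord_space n" using \<open>i < n\<close> by (auto simp: coord_space_def)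
    ultimately show "\<exists>x\<in>coord_space n. coord_dot n x m \<noteq> 0" using i by metis
  qed (auto simp: coord_dot_def algebra_simps sum.distrib sum_distrib_left)
qed

theorem theorem1:
  fixes \<delta> :: real
  assumes "\<delta> > 0"
  shows "\<exists>J\<^sub>0 N\<^sub>0 :: nat. \<forall>n \<ge> N\<^sub>0.
    \<forall>(f :: 'p::prime_card mod_ring vec \<Rightarrow> real) (\<theta> :: real) (a :: nat \<Rightarrow> 'p mod_ring vec).
      let F = real (CARD('p) ^ n);
          S = {m \<in> carrier_vec n. f m > 0}
      in n \<ge> 1 \<longrightarrow>
         (\<forall>m \<in> carrier_vec n. 0 \<le> f m \<and> f m \<le> 1) \<longrightarrow>
         mean n f = \<theta> \<longrightarrow>
         F powr (- 1 / 9) < \<theta> \<and> \<theta> \<le> 1 \<longrightarrow>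
         fourier_enumeration n f a \<longrightarrow>
         (\<exists>j :: nat. J\<^sub>0 < j \<and> real j < F powr (1 / 8) \<and>
            norm (fourier n f (a j)) < \<theta> powr (real j powr (1 / 2 + \<delta>)) * F) \<longrightarrow>
         (\<exists>m \<in> carrier_vec n. \<exists>d \<in> carrier_vec n.
            d \<noteq> 0\<^sub>v n \<and> m \<in> S \<and> m + d \<in> S \<and> m + 2 \<cdot>\<^sub>v d \<in> S) \<and>
         AP3_density n f > \<theta> / F"
proof -
  have p2: "2 \<le> CARD('p)" by (rule prime_ge_2_nat[OF prime_card])
  then have p1: "1 < real CARD('p)" by simp
  obtain k J\<^sub>0 :: nat where k2: "2 \<le> k" and params:
    "\<And>j \<theta> F. J\<^sub>0 < j \<Longrightarrow> 0 < \<theta> \<Longrightarrow> \<theta> \<le> 3 / 4 \<Longrightarrow> 1 \<le> F \<Longrightarrow>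
       F powr (-4) < \<theta> powr (real j powr (1 / 2 + \<delta>)) \<Longrightarrow>
       \<exists>s R \<kappa>. j \<le> k ^ (2 * s + 4) \<and> 4 * k ^ (s + 4) \<le> R \<and> 0 < \<kappa> \<and>
         4 * (real CARD('p) ^ R / \<theta>) ^ 3 * \<kappa> \<le> 1 \<and> 1 \<le> \<kappa> ^ 4 ^ Suc s * F \<and>
         \<theta> powr (real j powr (1 / 2 + \<delta>)) \<le> \<kappa> ^ 4 ^ Suc s * \<theta>"
    using gap_parameters[OF assms p1] by blast
  show ?thesis
    unfolding Let_def
  \<comment> \<open>dimension 3 makes the space have at least 8 elements\<close>
  proof (rule exI[of _ J\<^sub>0], rule exI[of _ 3], intro allI impI, elim exE conjE)
    fix n :: nat and f :: "'p mod_ring vec \<Rightarrow> real" and \<theta> :: real and a :: "nat \<Rightarrow> 'p mod_ring vec"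
      and j :: nat
    let ?F = "real (CARD('p) ^ n)"
    let ?C = "carrier_vec n :: 'p mod_ring vec set"
    assume n3: "3 \<le> n" and f01: "\<forall>m\<in>?C. 0 \<le> f m \<and> f m \<le> 1" and mean: "mean n f = \<theta>"
      and \<theta>: "?F powr (- 1 / 9) < \<theta>" "\<theta> \<le> 1" and enum: "fourier_enumeration n f a"
      and j: "J\<^sub>0 < j" "real j < ?F powr (1 / 8)"
        "norm (fourier n f (a j)) < \<theta> powr (real j powr (1 / 2 + \<delta>)) * ?F"
    define V :: "(nat \<Rightarrow> 'p mod_ring) set" where "V = coord_space n"
    define g where "g x = f (vec n x)" for x
    interpret ds: dot_space "\<lambda>(k :: 'p mod_ring) x i. k * x i" V "coord_dot n"
      unfolding V_def by (rule dot_space_coords)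
    have bij: "bij_betw (vec n) V ?C" unfolding V_def by (rule bij_betw_vec)
    have vecV: "vec n x \<in> ?C" for x :: "nat \<Rightarrow> 'p mod_ring" by simp
    have "bij_betw a {1..CARD('p) ^ n} ?C"
      using enum unfolding fourier_enumeration_def by blast
    then have FV: "real (card V) = ?F"
      using bij_betw_same_card[OF bij] bij_betw_same_card[of a "{1..CARD('p) ^ n}" ?C] by simp
    have "(2 :: nat) ^ 3 \<le> CARD('p) ^ 3" by (rule power_mono[OF p2]) simp
    also have "\<dots> \<le> CARD('p) ^ n" using p2 n3 by (intro power_increasing) auto
    finally have "real (2 ^ 3) \<le> ?F" by (rule of_nat_mono)
    then have F8: "8 \<le> ?F" by simp
    have "0 \<le> ?F powr (- 1 / 9)" by simp
    then have \<theta>0: "0 < \<theta>" using \<theta>(1) by linarith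
    have sum_f: "(\<Sum>m\<in>?C. f m) = \<theta> * ?F"
      using mean F8 unfolding mean_def by (auto simp: field_simps)
    have vec_add: "vec n (x + y) = vec n x + vec n y" for x y :: "nat \<Rightarrow> 'p mod_ring"
      by (rule eq_vecI) auto
    have vec_add2: "vec n (x + y + y) = vec n x + 2 \<cdot>\<^sub>v vec n y" for x y :: "nat \<Rightarrow> 'p mod_ring"
      by (rule eq_vecI) auto
    have sum_g: "(\<Sum>x\<in>V. g x) = \<theta> * real (card V)"
      unfolding g_def FV sum_f[symmetric] by (rule sum.reindex_bij_betw[OF bij])
    have ft_g: "ds.ft g x = fourier n f (vec n x)" for x
      unfolding ds.ft_def fourier_def g_def coord_dot_eq echar_def
      by (rule sum.reindex_bij_betw[OF bij])
    define N where "N = (\<Sum>m\<in>?C. \<Sum>d\<in>?C. f m * f (m + d) * f (m + 2 \<cdot>\<^sub>v d))"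
    have "ds.ap3 g = (\<Sum>x\<in>V. \<Sum>y\<in>V. f (vec n x) * f (vec n x + vec n y) * f (vec n x + 2 \<cdot>\<^sub>v vec n y))"
      unfolding ds.ap3_def g_def vec_add2 unfolding vec_add ..
    also have "\<dots> = (\<Sum>x\<in>V. \<Sum>d\<in>?C. f (vec n x) * f (vec n x + d) * f (vec n x + 2 \<cdot>\<^sub>v d))"
      by (intro sum.cong refl sum.reindex_bij_betw[OF bij])
    also have "\<dots> = N" unfolding N_def by (rule sum.reindex_bij_betw[OF bij])
    finally have ap3_g: "ds.ap3 g = N" .
    have "?F powr (1 / 8) \<le> ?F powr 1" using F8 by (intro powr_mono) auto
    then have "?F powr (1 / 8) \<le> ?F" by simp
    then have "real j \<le> ?F" using j(2) by linarith
    then have jF: "j \<le> CARD('p) ^ n" by (simp only: of_nat_le_iff)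
    have enum': "bij_betw a {1..CARD('p) ^ n} ?C"
      "\<And>i. j \<le> i \<Longrightarrow> i \<le> CARD('p) ^ n \<Longrightarrow> norm (fourier n f (a i)) \<le> norm (fourier n f (a j))"
      using enum j(1) unfolding fourier_enumeration_def by auto
    \<comment> \<open>everything after the first \<open>j - 1\<close> frequencies has coefficients of size at most that of \<open>a j\<close>\<close>
    define X where "X = {x \<in> V. vec n x \<in> a ` {1..<j}}"
    have finX: "finite X" "X \<subseteq> V" unfolding X_def using ds.finite_V by auto
    have "card X \<le> card (a ` {1..<j})"
      using bij unfolding X_def bij_betw_def
      by (intro card_inj_on_le[of "vec n"]) (auto intro: inj_on_subset)
    also have "\<dots> \<le> card {1..<j}" by (rule card_image_le) simp
    finally have cardX: "card X \<le> j" by simp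
    have off_X: "norm (ds.ft g x) \<le> norm (fourier n f (a j))" if x: "x \<in> V" "x \<notin> X" for x
    proof -
      have "vec n x \<in> a ` {1..CARD('p) ^ n}"
        using enum'(1) vecV unfolding bij_betw_def by blast
      then obtain i where i: "i \<in> {1..CARD('p) ^ n}" "vec n x = a i" by blast
      have "\<not> i < j" using x i unfolding X_def by auto
      then show ?thesis unfolding ft_g i(2) using enum'(2) i(1) by simp
    qed
    have "\<theta> * real (card V) < ds.ap3 g"
    proof (rule ds.ap3_gt_of_spectral_gap[where X = X and j = j and k = k
          and \<eta> = "norm (fourier n f (a j))" and L = "real j powr (1 / 2 + \<delta>)"])
      show "0 \<le> g m" "g m \<le> 1" for m
        unfolding g_def using f01 vecV[of m] by blast+
    qed (use sum_g F8 \<theta> j finX cardX off_X k2 params[of j \<theta> ?F] \<theta>0 in \<open>simp_all only: FV norm_ge_zero\<close>)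
    then have N: "\<theta> * ?F < N" unfolding FV ap3_g .
    have F0: "0 < ?F" using F8 by linarith
    have dens: "\<theta> / ?F < AP3_density n f"
      unfolding AP3_density_def N_def[symmetric] using N F0
      by (simp add: divide_less_eq power2_eq_square field_simps)
    \<comment> \<open>the trivial progressions contribute at most the sum of f, so they cannot account for the whole count\<close>
    have "\<exists>m\<in>?C. \<exists>d\<in>?C. d \<noteq> 0\<^sub>v n \<and> f m > 0 \<and> f (m + d) > 0 \<and> f (m + 2 \<cdot>\<^sub>v d) > 0"
    proof (rule ccontr)
      assume no: "\<not> ?thesis"
      have "(\<Sum>d\<in>?C. f m * f (m + d) * f (m + 2 \<cdot>\<^sub>v d)) \<le> f m" if m: "m \<in> ?C" for m
      proof -
        have "(\<Sum>d\<in>?C. f m * f (m + d) * f (m + 2 \<cdot>\<^sub>v d)) \<le> (\<Sum>d\<in>?C. if d = 0\<^sub>v n then f m else 0)"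
        proof (rule sum_mono)
          fix d assume d: "d \<in> ?C"
          have C: "m + d \<in> ?C" "m + 2 \<cdot>\<^sub>v d \<in> ?C" using m d by auto
          show "f m * f (m + d) * f (m + 2 \<cdot>\<^sub>v d) \<le> (if d = 0\<^sub>v n then f m else 0)"
          proof (cases "d = 0\<^sub>v n")
            case True
            have "f m * (f (m + d) * f (m + 2 \<cdot>\<^sub>v d)) \<le> f m * 1"
              using f01 m C by (intro mult_left_mono mult_le_one) auto
            then show ?thesis using True by (simp add: mult.assoc)
          next
            case False
            then have "f m = 0 \<or> f (m + d) = 0 \<or> f (m + 2 \<cdot>\<^sub>v d) = 0"
              using no m d C f01 by (metis order_le_less)
            then show ?thesis using False by auto
          qed
        qed
        also have "\<dots> = f m" by (simp add: finite_carrier_vec_of_finite)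
        finally show ?thesis .
      qed
      then have "N \<le> (\<Sum>m\<in>?C. f m)" unfolding N_def by (rule sum_mono)
      then show False using N sum_f by simp
    qed
    then obtain m d where md: "m \<in> ?C" "d \<in> ?C" "d \<noteq> 0\<^sub>v n" "f m > 0" "f (m + d) > 0"
      "f (m + 2 \<cdot>\<^sub>v d) > 0" by blast
    then have "\<exists>m\<in>?C. \<exists>d\<in>?C. d \<noteq> 0\<^sub>v n \<and> m \<in> {m \<in> ?C. f m > 0} \<and>
        m + d \<in> {m \<in> ?C. f m > 0} \<and> m + 2 \<cdot>\<^sub>v d \<in> {m \<in> ?C. f m > 0}"
      by (intro bexI[of _ m] bexI[of _ d]) auto
    with dens show "(\<exists>m\<in>?C. \<exists>d\<in>?C. d \<noteq> 0\<^sub>v n \<and> m \<in> {m \<in> ?C. f m > 0} \<and>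
        m + d \<in> {m \<in> ?C. f m > 0} \<and> m + 2 \<cdot>\<^sub>v d \<in> {m \<in> ?C. f m > 0}) \<and> \<theta> / ?F < AP3_density n f"
      by blast
  qed
qed

end
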